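(* Let $\varepsilon>0$ be a constant and let $S\subseteq[u]$ be an arbitrary set of size at most $|\Sigma|/(1+\varepsilon)$. Let $h_1:\Sigma^c\to\Sigma^d$ and $h_2:\Sigma^d\to\mathcal R$ be independent simple tabulation functions. With probability $1-O(|\Sigma|^{1-\lfloor d/2\rfloor})$ over the choice of $h_1$, the double tabulation function $h_2\circ h_1$ is fully random over $S$ (i.e. the values $h_2(h_1(x))$, $x\in S$, are independent and uniform in $\mathcal R$ over the choice of $h_2$).
   Context: Simple tabulation: fix an integer $c\ge1$ and an alphabet $\Sigma$ whose size is a power of two. A key $x\in[u]$ is viewed as a vector $(x_0,\dots,x_{c-1})$ of $c$ characters in $\Sigma$. A simple tabulation function $g:\Sigma^c\to\mathcal R$ ($\mathcal R=[2^r]$ bit strings, or $\Sigma^d$) is given by independent fully random tables $T_i:\Sigma\to\mathcal R$ with $g(x)=T_0[x_0]\oplus\cdots\oplus T_{c-1}[x_{c-1}]$ (bitwise XOR); analogously for domain $\Sigma^d$. Standing assumptions: $c,d=O(1)$, $u^{1/c}\le|\Sigma|\le u^{1/(c-1)}$; constants in $O(\cdot)$ may depend on $c,d,\varepsilon$. *)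

theory Defs
  imports "HOL-Probability.Probability"
begin

text \<open>
  Characters are the numbers below \<open>2 ^ k\<close>, so that the library operation \<open>xor\<close> on \<^typ>\<open>nat\<close>
  is the bitwise exclusive or of \<open>k\<close>-bit strings. Vectors of characters are lists.
\<close>

definition alphabet :: "nat \<Rightarrow> nat set" where
  "alphabet k = {..<2 ^ k}"

definition vecs :: "nat \<Rightarrow> 'a set \<Rightarrow> 'a list set" where
  "vecs n A = {v. length v = n \<and> set v \<subseteq> A}"

text \<open>
  A key is viewed as the vector of its \<open>c\<close> base-\<open>2 ^ k\<close> digits, least significant first.
  This is injective on the keys below \<open>(2 ^ k) ^ c\<close>.
\<close>

definition key_vec :: "nat \<Rightarrow> nat \<Rightarrow> nat \<Rightarrow> nat list" where
  "key_vec k c x = map (\<lambda>i. x div (2 ^ k) ^ i mod 2 ^ k) [0..<c]"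

definition xor_vec :: "nat list \<Rightarrow> nat list \<Rightarrow> nat list" where
  "xor_vec v w = map2 xor v w"

text \<open>
  The exclusive or \<open>f\<close> of the range and its neutral element \<open>z\<close> are parameters, because the
  range is either a set of bit strings or a set of vectors of characters.
\<close>

definition simple_tab ::
  "('r \<Rightarrow> 'r \<Rightarrow> 'r) \<Rightarrow> 'r \<Rightarrow> (nat \<Rightarrow> nat \<Rightarrow> 'r) \<Rightarrow> nat list \<Rightarrow> 'r" where
  "simple_tab f z T x = foldr (\<lambda>i. f (T i (x ! i))) [0..<length x] z"

text \<open>
  All table entries \<open>T i a\<close> with \<open>i < n\<close> and \<open>a \<in> A\<close> are independent and uniform in \<open>R\<close>; the
  entries outside this range are fixed to a dummy value.
\<close>

definition random_tables :: "nat \<Rightarrow> nat set \<Rightarrow> 'r set \<Rightarrow> (nat \<Rightarrow> nat \<Rightarrow> 'r) pmf" where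
  "random_tables n A R =
     Pi_pmf {..<n} undefined (\<lambda>i. Pi_pmf A undefined (\<lambda>a. pmf_of_set R))"

definition simple_tab_bits :: "nat \<Rightarrow> nat \<Rightarrow> nat \<Rightarrow> (nat list \<Rightarrow> nat) pmf" where
  "simple_tab_bits k n r =
     map_pmf (simple_tab xor 0) (random_tables n (alphabet k) {..<2 ^ r})"

definition simple_tab_chars :: "nat \<Rightarrow> nat \<Rightarrow> nat \<Rightarrow> (nat list \<Rightarrow> nat list) pmf" where
  "simple_tab_chars k n d =
     map_pmf (simple_tab xor_vec (replicate d 0))
       (random_tables n (alphabet k) (vecs d (alphabet k)))"

definition fully_random_over :: "('a \<Rightarrow> 'r) pmf \<Rightarrow> 'a set \<Rightarrow> 'r set \<Rightarrow> bool" where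
  "fully_random_over H S R \<longleftrightarrow>
     prob_space.indep_vars (measure_pmf H) (\<lambda>_. count_space UNIV) (\<lambda>x h. h x) S \<and>
     (\<forall>x\<in>S. map_pmf (\<lambda>h. h x) H = pmf_of_set R)"

end

(*
  The values of a simple tabulation function on keys without a zero-sum subset (a nonempty subset
  in which every position-character pair occurs an even number of times) are independent and
  uniform. Hence it suffices to bound the probability that some nonempty set Y of keys is mapped
  by h1 to a zero-sum set, i.e. that every output coordinate of h1 has only fibers of even size
  on Y.

  Two output coordinates f, g with this property split Y into cycles alternating between pairs
  of equal f-value and pairs of equal g-value. The cycle of a starting key x0 is followed until
  it closes, until its keys become dependent, or for O(log |Sigma|) steps. Each new independent
  key contributes a factor |S| / |Sigma| <= 1 / (1 + eps) to the union bound, and each of the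
  three ways to stop contributes a further factor O(1 / |Sigma|); for the dependent keys this is
  a bound on the number of zero-sum tuples of keys. That bound only holds on average over x0, so
  the keys are ordered such that x0 lies in few zero-sum tuples formed with later keys; every Y
  is explored from its first key.

  Disjoint pairs of coordinates are independent, so floor(d / 2) of them and the choice of x0
  give |S| * O(1 / |Sigma|) ^ floor(d / 2).
*)

theory Submission
  imports Defs
begin

subsection \<open>Solvability of XOR systems and uniformity\<close>

text \<open>Let \<open>w\<close> be the number of keys and \<open>m\<close> the alphabet size. A
  zero-sum set of \<open>2 * t\<close> positions leaves about \<open>w ^ (q - t)\<close> walks,
  while the independent part of the walk still supplies \<open>q - 1\<close> equations, so with
  \<open>w\<close> at most \<open>\<rho> * m\<close> the product is about
  \<open>\<rho> ^ (q - t) / m ^ (t - 1)\<close>. A repeated key is the case \<open>t = 1\<close>,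
  where this gains nothing; it needs the structural fact that a walk along matchings can only return
  to its start, and the closing edge is then one more equation. From \<open>t = 2\<close> on a
  factor \<open>1 / m\<close> is gained. The combinatorial cost is the \<open>t\<close>-th power of
  a polynomial in \<open>q\<close>: geometric decay pays for two of these factors, and each of the
  others needs its own \<open>1 / m\<close>, which suffices only while \<open>q\<close> is
  logarithmic in \<open>m\<close>. The count of zero-sum tuples comes from Cauchy-Schwarz and
  charges each position the square root of its number of choices. With a pinned start it gives only
  \<open>w ^ (t - 1/2)\<close>, hence \<open>m ^ (-1/2)\<close> per pair of coordinates; the average
  over starts is \<open>w ^ (t - 1)\<close>, and the ordering of the keys recovers it.\<close>

interpretation xor_nat: comm_monoid_set "xor :: nat \<Rightarrow> nat \<Rightarrow> nat" 0
  by (simp add: comm_monoid_set_def xor.comm_monoid_axioms)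

lemma xor_nat_less_power: "x < 2 ^ n \<Longrightarrow> y < 2 ^ n \<Longrightarrow> xor x y < 2 ^ n" for x y :: nat
  by (metis take_bit_nat_eq_self take_bit_nat_less_exp take_bit_xor)

lemma xor_sum_less_power:
  "(\<And>e. e \<in> E \<Longrightarrow> g e < 2 ^ r) \<Longrightarrow> xor_nat.F g E < 2 ^ r"
  by (induction E rule: infinite_finite_induct) (auto intro: xor_nat_less_power)

definition even_fibers :: "('i \<Rightarrow> 'a) \<Rightarrow> 'i set \<Rightarrow> bool" where
  "even_fibers f I \<longleftrightarrow> (\<forall>a. even (card {i \<in> I. f i = a}))"

text \<open>With a key read as the 0/1 vector of its position-character pairs, this is a vanishing
  sum over GF(2). Indexed families are used instead of sets so that a walk visiting one key twice
  already contains a zero-sum pair.\<close>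

definition zero_sum :: "nat \<Rightarrow> ('i \<Rightarrow> 'a list) \<Rightarrow> 'i set \<Rightarrow> bool" where
  "zero_sum n x I \<longleftrightarrow> (\<forall>p<n. even_fibers (\<lambda>i. x i ! p) I)"

text \<open>Linear independence over GF(2) of the vectors just described; in particular the keys are
  pairwise distinct.\<close>

definition independent_keys :: "nat \<Rightarrow> ('i \<Rightarrow> 'a list) \<Rightarrow> 'i set \<Rightarrow> bool" where
  "independent_keys n x I \<longleftrightarrow> (\<forall>J\<subseteq>I. J \<noteq> {} \<longrightarrow> \<not> zero_sum n x J)"

lemma odd_card_neq:
  assumes "finite J"
  shows "odd (card {i \<in> J. P i \<noteq> Q i}) \<longleftrightarrow> (odd (card {i \<in> J. P i}) \<noteq> odd (card {i \<in> J. Q i}))"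
  using assms
proof induction
  case (insert j J)
  have *: "card {i. (i = j \<or> i \<in> J) \<and> R i} = (if R j then 1 else 0) + card {i \<in> J. R i}" for R
  proof -
    have "{i. (i = j \<or> i \<in> J) \<and> R i} = (if R j then {j} else {}) \<union> {i \<in> J. R i}" by auto
    then show ?thesis using insert by auto
  qed
  show ?case using insert.IH by (simp add: *) blast
qed simp

text \<open>The condition on the subsets \<open>J\<close> is linear independence of the rows of
  \<open>M\<close> over GF(2), so every right-hand side is attained. The unknowns are
  \<open>r\<close>-bit strings, since they become table entries.\<close>

lemma xor_system_solvable:
  fixes M :: "'i \<Rightarrow> 'e \<Rightarrow> bool" and v :: "'i \<Rightarrow> nat"
  assumes "finite I" "finite E"
    and "\<And>J. J \<subseteq> I \<Longrightarrow> J \<noteq> {} \<Longrightarrow> \<exists>e\<in>E. odd (card {i \<in> J. M i e})"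
    and "\<And>i. i \<in> I \<Longrightarrow> v i < 2 ^ r"
  shows "\<exists>T. (\<forall>e. T e < 2 ^ r) \<and> (\<forall>i\<in>I. xor_nat.F (\<lambda>e. if M i e then T e else 0) E = v i)"
  using assms
proof (induction I arbitrary: M v rule: finite_induct)
  case empty
  then show ?case by (intro exI[of _ "\<lambda>_. 0"]) auto
next
  case (insert i0 I)
  have "\<exists>e\<in>E. odd (card {i \<in> {i0}. M i e})"
    by (rule insert.prems(2)) auto
  then obtain p where p: "p \<in> E" "M i0 p"
    by (metis (mono_tags, lifting) card.empty empty_Collect_eq even_zero singletonD)
  \<comment> \<open>Gaussian elimination with pivot \<open>p\<close> in row \<open>i0\<close>.\<close>
  define M' where "M' i e \<longleftrightarrow> (M i e \<noteq> (M i p \<and> M i0 e))" for i e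
  define v' where "v' i = (if M i p then xor (v i) (v i0) else v i)" for i
  have ind: "\<exists>e\<in>E. odd (card {i \<in> J. M' i e})" if J: "J \<subseteq> I" "J \<noteq> {}" for J
  proof -
    have fJ: "finite J" using J insert by (meson finite_subset)
    \<comment> \<open>Row \<open>i0\<close> was added once for each \<open>i\<close> in
      \<open>J\<close> with \<open>M i p\<close>. The sum of the reduced rows over \<open>J\<close>
      is therefore the sum of the original rows over \<open>J'\<close>.\<close>
    define J' where "J' = (if odd (card {i \<in> J. M i p}) then insert i0 J else J)"
    have "J' \<subseteq> insert i0 I" "J' \<noteq> {}" using J by (auto simp: J'_def)
    then obtain e where e: "e \<in> E" "odd (card {i \<in> J'. M i e})"
      using insert.prems(2) by blast
    have i0: "i0 \<notin> J" using J insert by auto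
    have *: "odd (card {i \<in> insert i0 J. M i e}) \<longleftrightarrow> (M i0 e \<noteq> odd (card {i \<in> J. M i e}))"
    proof -
      have "{i \<in> insert i0 J. M i e} = (if M i0 e then insert i0 else id) {i \<in> J. M i e}" by auto
      then show ?thesis using fJ i0 by auto
    qed
    have "odd (card {i \<in> J. M' i e}) \<longleftrightarrow>
      (odd (card {i \<in> J. M i e}) \<noteq> odd (card {i \<in> J. M i p \<and> M i0 e}))"
      unfolding M'_def by (rule odd_card_neq[OF fJ])
    also have "\<dots> \<longleftrightarrow> odd (card {i \<in> J'. M i e})"
      using * by (cases "M i0 e") (auto simp: J'_def)
    finally show ?thesis using e by auto
  qed
  have "\<exists>T. (\<forall>e. T e < 2 ^ r) \<and> (\<forall>i\<in>I. xor_nat.F (\<lambda>e. if M' i e then T e else 0) E = v' i)"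
    by (rule insert.IH) (use insert.prems ind in \<open>auto simp: v'_def intro: xor_nat_less_power\<close>)
  then obtain T where T: "\<And>e. T e < 2 ^ r"
    "\<And>i. i \<in> I \<Longrightarrow> xor_nat.F (\<lambda>e. if M' i e then T e else 0) E = v' i" by blast
  \<comment> \<open>Row \<open>i0\<close> is solved for the unknown at the pivot. Column
    \<open>p\<close> of \<open>M'\<close> is zero, so this change leaves the reduced equations
    intact.\<close>
  define t where "t = xor (v i0) (xor_nat.F (\<lambda>e. if M i0 e then T e else 0) (E - {p}))"
  define U where "U = T(p := t)"
  have Ui0: "xor_nat.F (\<lambda>e. if M i0 e then U e else 0) E = v i0"
  proof -
    have "xor_nat.F (\<lambda>e. if M i0 e then U e else 0) E
      = xor t (xor_nat.F (\<lambda>e. if M i0 e then U e else 0) (E - {p}))"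
      using p insert.prems by (subst xor_nat.remove[of _ p]) (auto simp: U_def)
    also have "xor_nat.F (\<lambda>e. if M i0 e then U e else 0) (E - {p})
       = xor_nat.F (\<lambda>e. if M i0 e then T e else 0) (E - {p})"
      by (rule xor_nat.cong) (auto simp: U_def)
    finally show ?thesis by (simp add: t_def xor.assoc)
  qed
  have "t < 2 ^ r"
    unfolding t_def using T insert.prems by (intro xor_nat_less_power xor_sum_less_power) auto
  then have "\<forall>e. U e < 2 ^ r" using T by (auto simp: U_def)
  moreover have "xor_nat.F (\<lambda>e. if M i e then U e else 0) E = v i" if i: "i \<in> I" for i
  proof -
    have "xor_nat.F (\<lambda>e. if M' i e then U e else 0) E = xor_nat.F (\<lambda>e. if M' i e then T e else 0) E"
      by (rule xor_nat.cong) (use p in \<open>auto simp: U_def M'_def\<close>)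
    then have *: "xor_nat.F (\<lambda>e. if M' i e then U e else 0) E = v' i" using T i by simp
    have "xor_nat.F (\<lambda>e. if M i e then U e else 0) E
      = xor_nat.F (\<lambda>e. xor (if M' i e then U e else 0) (if M i p then (if M i0 e then U e else 0) else 0)) E"
      by (rule xor_nat.cong) (auto simp: M'_def)
    also have "\<dots> = xor (v' i) (if M i p then v i0 else 0)"
      using * Ui0 by (cases "M i p") (simp_all add: xor_nat.distrib)
    also have "\<dots> = v i" by (simp add: v'_def xor.assoc)
    finally show ?thesis .
  qed
  ultimately show ?case using Ui0 by blast
qed

lemma simple_tab_xor_eq_sum:
  "simple_tab xor 0 T x = xor_nat.F (\<lambda>p. T p (x ! p)) {..<length x}"
proof -
  have "foldr (\<lambda>i. xor (g i)) ps 0 = xor_nat.F g (set ps)" if "distinct ps" for g and ps :: "nat list"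
    using that by (induction ps) auto
  from this[of "[0..<length x]"] show ?thesis
    by (simp add: simple_tab_def atLeast0LessThan)
qed

lemma simple_tab_xor_less:
  assumes "\<And>p. p < length x \<Longrightarrow> T p (x ! p) < 2 ^ r"
  shows "simple_tab xor 0 T x < (2 :: nat) ^ r"
  unfolding simple_tab_xor_eq_sum by (rule xor_sum_less_power) (use assms in auto)

text \<open>Hashing is linear in the tables, and the coefficient of the entry \<open>(p, a)\<close>
  is the truth value of \<open>x ! p = a\<close>. Changing hash values by a mask \<open>D\<close> is
  thus a linear system of the form solved above.\<close>

lemma simple_tab_xor_shift:
  assumes x: "x \<in> vecs n A" and A: "finite A"
  shows "simple_tab xor 0 (\<lambda>p a. if p < n \<and> a \<in> A then xor (T p a) (D (p, a)) else T p a) x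
    = xor (simple_tab xor 0 T x)
        (xor_nat.F (\<lambda>e. if x ! fst e = snd e then D e else 0) ({..<n} \<times> A))"
proof -
  have len: "length x = n" and xA: "\<And>p. p < n \<Longrightarrow> x ! p \<in> A"
    using x nth_mem by (fastforce simp: vecs_def)+
  have "xor_nat.F (\<lambda>e. if x ! fst e = snd e then D e else 0) ({..<n} \<times> A)
    = xor_nat.F (\<lambda>p. xor_nat.F (\<lambda>a. if x ! p = a then D (p, a) else 0) A) {..<n}"
    unfolding xor_nat.cartesian_product by (rule xor_nat.cong) auto
  also have "\<dots> = xor_nat.F (\<lambda>p. D (p, x ! p)) {..<n}"
    by (rule xor_nat.cong) (use xA A in \<open>auto simp: xor_nat.delta'\<close>)
  finally have "xor_nat.F (\<lambda>e. if x ! fst e = snd e then D e else 0) ({..<n} \<times> A)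
    = xor_nat.F (\<lambda>p. D (p, x ! p)) {..<n}" .
  then show ?thesis
    by (simp add: simple_tab_xor_eq_sum len flip: xor_nat.distrib)
       (rule xor_nat.cong, use xA in auto)
qed

section \<open>Uniform and independent hash values on independent keys\<close>

lemma map_pmf_of_set_equal_fibers:
  assumes "finite A" "A \<noteq> {}" "finite B" "f ` A \<subseteq> B"
    and eq: "\<And>v w. v \<in> B \<Longrightarrow> w \<in> B \<Longrightarrow> card {a \<in> A. f a = v} \<le> card {a \<in> A. f a = w}"
  shows "map_pmf f (pmf_of_set A) = pmf_of_set B"
proof (rule pmf_eqI)
  have B: "B \<noteq> {}" using assms by auto
  fix w
  have pmf: "pmf (map_pmf f (pmf_of_set A)) w = card {a \<in> A. f a = w} / card A"
    using assms by (simp add: pmf_map measure_pmf_of_set vimage_def Int_def)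
  show "pmf (map_pmf f (pmf_of_set A)) w = pmf (pmf_of_set B) w"
  proof (cases "w \<in> B")
    case True
    have "card A = (\<Sum>v\<in>B. card {a \<in> A. f a = v})"
    proof -
      have "A = (\<Union>v\<in>B. {a \<in> A. f a = v})" using assms(4) by auto
      then have "card A = card (\<Union>v\<in>B. {a \<in> A. f a = v})" by simp
      also have "\<dots> = (\<Sum>v\<in>B. card {a \<in> A. f a = v})"
        using assms by (intro card_UN_disjoint) auto
      finally show ?thesis .
    qed
    also have "\<dots> = (\<Sum>v\<in>B. card {a \<in> A. f a = w})"
      using eq True by (intro sum.cong refl antisym) auto
    finally have c: "card A = card B * card {a \<in> A. f a = w}" by simp
    moreover have "card A \<noteq> 0" using assms by auto
    ultimately have "card {a \<in> A. f a = w} \<noteq> 0" by auto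
    then show ?thesis unfolding pmf using True assms B by (simp add: c)
  next
    case False
    then have "{a \<in> A. f a = w} = {}" using assms by auto
    then show ?thesis unfolding pmf using False assms B by simp
  qed
qed

lemma random_tables_eq_pmf_of_set:
  assumes "finite A" "finite R" "R \<noteq> {}"
  shows "random_tables n A R =
    pmf_of_set (PiE_dflt {..<n} undefined (\<lambda>_. PiE_dflt A undefined (\<lambda>_. R)))"
  unfolding random_tables_def using assms
  by (simp add: Pi_pmf_of_set finite_PiE_dflt)

lemma finite_random_tables [simp]:
  "finite A \<Longrightarrow> finite R \<Longrightarrow> finite (PiE_dflt {..<n::nat} undefined (\<lambda>_. PiE_dflt A undefined (\<lambda>_. R)))"
  by auto

lemma not_zero_sum_odd:
  assumes "\<And>i. i \<in> J \<Longrightarrow> x i \<in> vecs n A" and "\<not> zero_sum n x J"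
  shows "\<exists>e\<in>{..<n} \<times> A. odd (card {i \<in> J. x i ! fst e = snd e})"
proof -
  obtain p a where pa: "p < n" "odd (card {i \<in> J. x i ! p = a})"
    using assms by (auto simp: zero_sum_def even_fibers_def)
  have "{i \<in> J. x i ! p = a} \<noteq> {}" using pa(2) by (metis card.empty even_zero)
  then have "a \<in> A" using assms(1) pa(1) nth_mem by (fastforce simp: vecs_def)
  then show ?thesis using pa by force
qed

text \<open>Independence allows a mask \<open>D\<close> that changes the hash values from
  \<open>v\<close> to \<open>w\<close> on all of \<open>I\<close> at once. XORing the tables with
  \<open>D\<close> is an involution carrying the fiber of \<open>v\<close> into the fiber of
  \<open>w\<close>, so all fibers have the same size and a uniform choice of tables gives uniform
  value vectors.\<close>

lemma simple_tab_independent_keys_uniform: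
  fixes x :: "'i \<Rightarrow> nat list"
  assumes I: "finite I" and A: "finite A" and x: "\<And>i. i \<in> I \<Longrightarrow> x i \<in> vecs n A"
    and ind: "independent_keys n x I"
  shows "map_pmf (\<lambda>T i. if i \<in> I then simple_tab xor 0 T (x i) else undefined)
      (random_tables n A {..<2 ^ r :: nat}) = Pi_pmf I undefined (\<lambda>_. pmf_of_set {..<2 ^ r})"
proof -
  let ?W = "PiE_dflt {..<n} undefined (\<lambda>_. PiE_dflt A undefined (\<lambda>_. {..<2 ^ r :: nat}))"
  let ?B = "PiE_dflt I undefined (\<lambda>_. {..<2 ^ r :: nat})"
  let ?f = "\<lambda>T i. if i \<in> I then simple_tab xor 0 T (x i) else (undefined :: nat)"
  have rng: "simple_tab xor 0 T (x i) < (2 :: nat) ^ r" if "T \<in> ?W" "i \<in> I" for T i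
  proof (rule simple_tab_xor_less)
    fix p assume p: "p < length (x i)"
    then have "p < n" "x i ! p \<in> A" using x[OF that(2)] nth_mem by (fastforce simp: vecs_def)+
    then show "T p (x i ! p) < 2 ^ r" using that(1) by (auto simp: PiE_dflt_def)
  qed
  have "map_pmf ?f (pmf_of_set ?W) = pmf_of_set ?B"
  proof (rule map_pmf_of_set_equal_fibers)
    show "?f ` ?W \<subseteq> ?B" using rng by (auto simp: PiE_dflt_def)
    fix v w assume v: "v \<in> ?B" and w: "w \<in> ?B"
    have "\<exists>D. (\<forall>e. D e < 2 ^ r) \<and>
      (\<forall>i\<in>I. xor_nat.F (\<lambda>e. if x i ! fst e = snd e then D e else 0) ({..<n} \<times> A) = xor (v i) (w i))"
    proof (rule xor_system_solvable[OF I])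
      fix J assume "J \<subseteq> I" "J \<noteq> {}"
      then show "\<exists>e\<in>{..<n} \<times> A. odd (card {i \<in> J. x i ! fst e = snd e})"
        using x ind by (intro not_zero_sum_odd) (auto simp: independent_keys_def)
    qed (use A v w in \<open>auto simp: PiE_dflt_def intro!: xor_nat_less_power\<close>)
    then obtain D where D: "\<And>e. D e < 2 ^ r" "\<And>i. i \<in> I \<Longrightarrow>
        xor_nat.F (\<lambda>e. if x i ! fst e = snd e then D e else 0) ({..<n} \<times> A) = xor (v i) (w i)"
      by blast
    let ?s = "\<lambda>T p a. if p < n \<and> a \<in> A then xor (T p a) (D (p, a)) else T p a"
    have inv: "?s (?s T) = T" for T by (auto simp: xor.assoc fun_eq_iff)
    show "card {T \<in> ?W. ?f T = v} \<le> card {T \<in> ?W. ?f T = w}"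
    proof (rule card_inj_on_le[of ?s])
      show "inj_on ?s {T \<in> ?W. ?f T = v}" by (rule inj_on_inverseI[of _ ?s]) (rule inv)
      show "?s ` {T \<in> ?W. ?f T = v} \<subseteq> {T \<in> ?W. ?f T = w}"
      proof (rule image_subsetI)
        fix T assume T: "T \<in> {T \<in> ?W. ?f T = v}"
        have "?s T \<in> ?W" using T D(1) by (auto simp: PiE_dflt_def intro: xor_nat_less_power)
        moreover have "?f (?s T) = w"
        proof
          fix i
          show "?f (?s T) i = w i"
          proof (cases "i \<in> I")
            case True
            have "simple_tab xor 0 T (x i) = v i" using T True by (auto dest: fun_cong[of _ _ i])
            then show ?thesis using True
              by (simp only: simple_tab_xor_shift[OF x[OF True] A] D(2)[OF True] if_True)
                 (simp flip: xor.assoc)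
          qed (use w in \<open>auto simp: PiE_dflt_def\<close>)
        qed
        ultimately show "?s T \<in> {T \<in> ?W. ?f T = w}" by simp
      qed
      show "finite {T \<in> ?W. ?f T = w}" using A by simp
    qed
  qed (use A I in \<open>auto simp: lessThan_empty_iff\<close>)
  moreover have "random_tables n A {..<2 ^ r :: nat} = pmf_of_set ?W"
    using A by (intro random_tables_eq_pmf_of_set) (auto simp: lessThan_empty_iff)
  moreover have "Pi_pmf I undefined (\<lambda>_. pmf_of_set {..<2 ^ r :: nat}) = pmf_of_set ?B"
    using I by (intro Pi_pmf_of_set) (auto simp: lessThan_empty_iff)
  ultimately show ?thesis by simp
qed

text \<open>Only the joint law on \<open>S\<close> matters. Fixing the values outside
  \<open>S\<close> makes this law literally a \<open>Pi_pmf\<close>, whose evaluations are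
  independent by construction.\<close>

lemma fully_random_overI:
  assumes S: "finite S"
    and H: "map_pmf (\<lambda>h x. if x \<in> S then h x else undefined) H = Pi_pmf S undefined (\<lambda>_. pmf_of_set R)"
  shows "fully_random_over H S R"
proof -
  let ?f = "\<lambda>h x. if x \<in> S then h x else undefined"
  let ?P = "Pi_pmf S undefined (\<lambda>_. pmf_of_set R)"
  have ind: "prob_space.indep_vars (measure_pmf ?P) (\<lambda>_. count_space UNIV) (\<lambda>x h. h x) S"
    by (rule indep_vars_Pi_pmf[OF S])
  have "prob_space.indep_vars (measure_pmf H) (\<lambda>_. count_space UNIV) (\<lambda>x h. h x) S"
    unfolding prob_space.indep_vars_def2[OF measure_pmf.prob_space_axioms]
  proof (intro conjI ballI prob_space.indep_setsI[OF measure_pmf.prob_space_axioms])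
    fix B J assume J: "J \<noteq> {}" "J \<subseteq> S" "finite J"
      and B: "\<forall>j\<in>J. B j \<in> {(\<lambda>h. h j) -` C \<inter> space (measure_pmf H) |C. C \<in> sets (count_space UNIV)}"
    then obtain C where C: "\<And>j. j \<in> J \<Longrightarrow> B j = (\<lambda>h. h j) -` C j" by simp metis
    have eq: "measure_pmf.prob H (\<Inter>j\<in>K. B j) = measure_pmf.prob ?P (\<Inter>j\<in>K. (\<lambda>h. h j) -` C j)"
      if "K \<subseteq> J" for K
      unfolding H[symmetric] measure_map_pmf
      using that J by (intro arg_cong[where f = "measure_pmf.prob H"]) (auto simp: C subset_iff)
    have "measure_pmf.prob ?P (\<Inter>j\<in>J. (\<lambda>h. h j) -` C j)
      = (\<Prod>j\<in>J. measure_pmf.prob ?P ((\<lambda>h. h j) -` C j))"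
      using prob_space.indep_varsD[OF measure_pmf.prob_space_axioms ind J(1,3,2), of C] by simp
    moreover have "measure_pmf.prob ?P ((\<lambda>h. h j) -` C j) = measure_pmf.prob H (B j)" if "j \<in> J" for j
      using eq[of "{j}"] that by simp
    ultimately show "measure_pmf.prob H (\<Inter> (B ` J)) = (\<Prod>j\<in>J. measure_pmf.prob H (B j))"
      using eq[of J] by simp
  qed auto
  moreover have "map_pmf (\<lambda>h. h x) H = pmf_of_set R" if "x \<in> S" for x
  proof -
    have "map_pmf (\<lambda>h. h x) H = map_pmf (\<lambda>h. h x) (map_pmf ?f H)"
      using that by (simp add: pmf.map_comp o_def)
    then show ?thesis using that S by (simp add: H Pi_pmf_component)
  qed
  ultimately show ?thesis by (simp add: fully_random_over_def)
qed

subsection \<open>Counting zero-sum tuples\<close>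

lemma even_fibers_cong: "(\<And>i. i \<in> I \<Longrightarrow> f i = g i) \<Longrightarrow> even_fibers f I = even_fibers g I"
proof -
  assume "\<And>i. i \<in> I \<Longrightarrow> f i = g i"
  then have "{i \<in> I. f i = a} = {i \<in> I. g i = a}" for a by auto
  then show ?thesis by (simp add: even_fibers_def)
qed

lemma zero_sum_cong: "(\<And>i. i \<in> I \<Longrightarrow> x i = y i) \<Longrightarrow> zero_sum n x I = zero_sum n y I"
  unfolding zero_sum_def by (simp cong: even_fibers_cong)

lemma even_fibers_obtain_partner:
  assumes "finite I" "even_fibers f I" "i \<in> I"
  obtains j where "j \<in> I" "j \<noteq> i" "f j = f i"
proof -
  have "{j \<in> I. f j = f i} \<noteq> {i}" 
  proof
    assume "{j \<in> I. f j = f i} = {i}"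
    then have "odd (card {j \<in> I. f j = f i})" by simp
    then show False using assms(2) by (simp add: even_fibers_def)
  qed
  then show ?thesis using assms(3) that by blast
qed

lemma even_fibers_remove_pair:
  assumes "finite I" "even_fibers f I" "i \<in> I" "j \<in> I" "i \<noteq> j" "f i = f j"
  shows "even_fibers f (I - {i, j})"
  unfolding even_fibers_def
proof
  fix a
  have "{l \<in> I. f l = a} = {l \<in> I - {i, j}. f l = a} \<union> (if f i = a then {i, j} else {})"
    using assms by auto
  then have "card {l \<in> I. f l = a} = card {l \<in> I - {i, j}. f l = a} + (if f i = a then 2 else 0)"
    using assms by (auto simp: card_Un_disjoint)
  moreover have "even (card {l \<in> I. f l = a})" using assms by (simp add: even_fibers_def)
  ultimately show "even (card {l \<in> I - {i, j}. f l = a})" by (auto split: if_splits)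
qed

text \<open>Some \<open>j\<close> has the same value as a fixed \<open>i0\<close>; removing both
  keeps the fibers even. The common value \<open>a\<close> contributes an inner product of
  \<open>g i0\<close> and \<open>g j\<close>, bounded by Cauchy-Schwarz, and each round has fewer
  than \<open>card I\<close> choices of the partner. The weights are needed for the induction over
  coordinates below, where \<open>g i a\<close> is the square root of a count.\<close>

lemma sum_even_fibers_le:
  fixes g :: "'i \<Rightarrow> 'a \<Rightarrow> real"
  assumes "finite I" "finite A" "\<And>i a. g i a \<ge> 0"
  shows "(\<Sum>\<alpha> | \<alpha> \<in> PiE I (\<lambda>_. A) \<and> even_fibers \<alpha> I. \<Prod>i\<in>I. g i (\<alpha> i))
    \<le> real (card I) ^ card I * (\<Prod>i\<in>I. L2_set (g i) A)"
  using assms(1)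
proof (induction I rule: finite_psubset_induct)
  case (psubset I)
  let ?Z = "\<lambda>I. {\<alpha>. \<alpha> \<in> PiE I (\<lambda>_. A) \<and> even_fibers \<alpha> I}"
  show ?case
  proof (cases "I = {}")
    case True
    then show ?thesis by (simp add: even_fibers_def)
  next
    case False
    then obtain i0 where i0: "i0 \<in> I" by blast
    define s where "s = card I"
    let ?I = "\<lambda>j. I - {i0, j}"
    let ?T = "SIGMA j:I - {i0}. A \<times> ?Z (?I j)"
    have fin: "finite (?Z J)" if "J \<subseteq> I" for J
      by (rule finite_subset[of _ "PiE J (\<lambda>_. A)"])
        (use psubset.hyps assms(2) that in \<open>auto intro!: finite_PiE dest: finite_subset\<close>)
    have "(\<Sum>\<alpha>\<in>?Z I. \<Prod>i\<in>I. g i (\<alpha> i))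
      \<le> (\<Sum>(j, a, \<beta>)\<in>?T. g i0 a * g j a * (\<Prod>i\<in>?I j. g i (\<beta> i)))"
    \<comment> \<open>A colouring is rebuilt from the partner of \<open>i0\<close>, their common
      value and its restriction to the other indices. Several partners may be possible, so the
      right-hand side may count it repeatedly.\<close>
    proof (rule sum_le_included[where i = "\<lambda>(j, a, \<beta>). \<beta>(i0 := a, j := a)"])
      show "finite ?T" using psubset.hyps assms(2) fin by auto
      show "\<forall>y\<in>?T. 0 \<le> (case y of (j, a, \<beta>) \<Rightarrow> g i0 a * g j a * (\<Prod>i\<in>?I j. g i (\<beta> i)))"
        using assms(3) by (auto intro!: mult_nonneg_nonneg prod_nonneg)
      show "\<forall>\<alpha>\<in>?Z I. \<exists>y\<in>?T. (case y of (j, a, \<beta>) \<Rightarrow> \<beta>(i0 := a, j := a)) = \<alpha> \<and>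
        (\<Prod>i\<in>I. g i (\<alpha> i)) \<le> (case y of (j, a, \<beta>) \<Rightarrow> g i0 a * g j a * (\<Prod>i\<in>?I j. g i (\<beta> i)))"
      proof
        fix \<alpha> assume \<alpha>: "\<alpha> \<in> ?Z I"
        then obtain j where j: "j \<in> I" "j \<noteq> i0" "\<alpha> j = \<alpha> i0"
          using even_fibers_obtain_partner[OF psubset.hyps(1) _ i0] by auto
        define \<beta> where "\<beta> = restrict \<alpha> (?I j)"
        have "even_fibers \<alpha> (?I j)"
          using \<alpha> j i0 psubset.hyps by (intro even_fibers_remove_pair) auto
        then have "even_fibers \<beta> (?I j)"
          by (subst even_fibers_cong[of _ _ \<alpha>]) (auto simp: \<beta>_def)
        moreover have "\<beta> \<in> PiE (?I j) (\<lambda>_. A)" using \<alpha> by (auto simp: \<beta>_def)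
        ultimately have "\<beta> \<in> ?Z (?I j)" by simp
        moreover have "\<beta>(i0 := \<alpha> i0, j := \<alpha> i0) = \<alpha>"
        proof
          fix i show "(\<beta>(i0 := \<alpha> i0, j := \<alpha> i0)) i = \<alpha> i"
            using PiE_arb[of \<alpha> I "\<lambda>_. A" i] \<alpha> j by (auto simp: \<beta>_def)
        qed
        moreover have "(\<Prod>i\<in>I. g i (\<alpha> i)) = g i0 (\<alpha> i0) * g j (\<alpha> i0) * (\<Prod>i\<in>?I j. g i (\<beta> i))"
        proof -
          have "(\<Prod>i\<in>I. g i (\<alpha> i)) = g i0 (\<alpha> i0) * (\<Prod>i\<in>I - {i0}. g i (\<alpha> i))"
            using i0 psubset.hyps by (intro prod.remove) auto
          also have "(\<Prod>i\<in>I - {i0}. g i (\<alpha> i)) = g j (\<alpha> j) * (\<Prod>i\<in>I - {i0} - {j}. g i (\<alpha> i))"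
            using j psubset.hyps by (intro prod.remove) auto
          also have "I - {i0} - {j} = ?I j" by auto
          finally show ?thesis using j(3) by (simp add: \<beta>_def)
        qed
        moreover have "\<alpha> i0 \<in> A" using \<alpha> i0 by auto
        ultimately show "\<exists>y\<in>?T. (case y of (j, a, \<beta>) \<Rightarrow> \<beta>(i0 := a, j := a)) = \<alpha> \<and>
        (\<Prod>i\<in>I. g i (\<alpha> i)) \<le> (case y of (j, a, \<beta>) \<Rightarrow> g i0 a * g j a * (\<Prod>i\<in>?I j. g i (\<beta> i)))"
          using j by (intro bexI[of _ "(j, \<alpha> i0, \<beta>)"]) auto
      qed
    qed (use fin in auto)
    also have "\<dots> = (\<Sum>j\<in>I - {i0}. (\<Sum>a\<in>A. g i0 a * g j a) * (\<Sum>\<beta>\<in>?Z (?I j). \<Prod>i\<in>?I j. g i (\<beta> i)))"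
      using psubset.hyps assms(2) fin
      by (subst sum.Sigma[symmetric]) (auto simp: sum_product sum.cartesian_product intro!: sum.cong)
    also have "\<dots> \<le> (\<Sum>j\<in>I - {i0}. real (s - 2) ^ (s - 2) * (\<Prod>i\<in>I. L2_set (g i) A))"
    proof (rule sum_mono)
      fix j assume j: "j \<in> I - {i0}"
      have card: "card (?I j) = s - 2"
        using i0 j by (auto simp: s_def card_Diff_subset)
      have "(\<Sum>a\<in>A. g i0 a * g j a) \<le> L2_set (g i0) A * L2_set (g j) A"
        using L2_set_mult_ineq[of "g i0" "g j" A] assms(3) by simp
      moreover have "(\<Sum>\<beta>\<in>?Z (?I j). \<Prod>i\<in>?I j. g i (\<beta> i))
        \<le> real (s - 2) ^ (s - 2) * (\<Prod>i\<in>?I j. L2_set (g i) A)"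
        using psubset.IH[of "?I j"] i0 unfolding card by blast
      ultimately have "(\<Sum>a\<in>A. g i0 a * g j a) * (\<Sum>\<beta>\<in>?Z (?I j). \<Prod>i\<in>?I j. g i (\<beta> i))
        \<le> (L2_set (g i0) A * L2_set (g j) A) * (real (s - 2) ^ (s - 2) * (\<Prod>i\<in>?I j. L2_set (g i) A))"
        using assms(3) by (intro mult_mono) (auto intro!: sum_nonneg prod_nonneg mult_nonneg_nonneg)
      also have "\<dots> = real (s - 2) ^ (s - 2) *
          (L2_set (g i0) A * (L2_set (g j) A * (\<Prod>i\<in>I - {i0} - {j}. L2_set (g i) A)))"
      proof -
        have "I - {i0} - {j} = ?I j" by auto
        then show ?thesis by (simp add: mult_ac)
      qed
      also have "L2_set (g i0) A * (L2_set (g j) A * (\<Prod>i\<in>I - {i0} - {j}. L2_set (g i) A))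
         = (\<Prod>i\<in>I. L2_set (g i) A)"
        using i0 j psubset.hyps prod.remove[of I i0 "\<lambda>i. L2_set (g i) A"]
          prod.remove[of "I - {i0}" j "\<lambda>i. L2_set (g i) A"] by simp
      finally show "(\<Sum>a\<in>A. g i0 a * g j a) * (\<Sum>\<beta>\<in>?Z (?I j). \<Prod>i\<in>?I j. g i (\<beta> i))
        \<le> real (s - 2) ^ (s - 2) * (\<Prod>i\<in>I. L2_set (g i) A)" .
    qed
    also have "\<dots> = (real (s - 1) * real (s - 2) ^ (s - 2)) * (\<Prod>i\<in>I. L2_set (g i) A)"
      using i0 psubset.hyps by (simp add: s_def)
    also have "\<dots> \<le> real s ^ s * (\<Prod>i\<in>I. L2_set (g i) A)"
    proof (rule mult_right_mono)
      have s: "s \<ge> 1" using i0 psubset.hyps by (auto simp: s_def Suc_le_eq card_gt_0_iff)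
      have "real (s - 1) * real (s - 2) ^ (s - 2) \<le> real s * real s ^ (s - 2)"
        by (intro mult_mono power_mono) auto
      also have "\<dots> = real s ^ Suc (s - 2)" by simp
      also have "\<dots> \<le> real s ^ s" using s by (intro power_increasing) auto
      finally show "real (s - 1) * real (s - 2) ^ (s - 2) \<le> real s ^ s" .
    qed (auto intro: prod_nonneg)
    finally show ?thesis by (simp add: s_def)
  qed
qed

text \<open>Every position has its own key set: one position gets pinned to a single key, and the
  induction over coordinates shrinks the sets differently.\<close>

definition zero_sum_tuples :: "nat \<Rightarrow> 'i set \<Rightarrow> ('i \<Rightarrow> 'a list set) \<Rightarrow> ('i \<Rightarrow> 'a list) set" where
  "zero_sum_tuples n I V = {x \<in> PiE I V. zero_sum n x I}"

lemma finite_vecs [simp]: "finite A \<Longrightarrow> finite (vecs n A)"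
  using finite_lists_length_eq[of A n] by (simp add: vecs_def conj_commute)

lemma finite_zero_sum_tuples:
  "finite I \<Longrightarrow> (\<And>i. i \<in> I \<Longrightarrow> finite (V i)) \<Longrightarrow> finite (zero_sum_tuples n I V)"
  unfolding zero_sum_tuples_def by (rule finite_subset[of _ "PiE I V"]) (auto intro!: finite_PiE)

text \<open>Induction on the key length. For fixed first characters \<open>\<alpha>\<close> the
  tails form a zero-sum tuple, counted by the induction hypothesis as a product of square roots.
  Summing over all \<open>\<alpha>\<close> with even fibers is the weighted sum above, and the
  \<open>L2_set\<close> norm of the square roots of the tail counts is the square root of their
  total.\<close>

lemma card_zero_sum_tuples_le:
  assumes "finite I" "finite A" "\<And>i. i \<in> I \<Longrightarrow> V i \<subseteq> vecs n A"
  shows "real (card (zero_sum_tuples n I V))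
    \<le> (real (card I) ^ card I) ^ n * (\<Prod>i\<in>I. sqrt (real (card (V i))))"
  using assms(3)
proof (induction n arbitrary: V)
  case 0
  \<comment> \<open>There is only one key of length 0, so each cardinality is 0 or 1 and equals its
    square root.\<close>
  have *: "real (card (V i)) = sqrt (real (card (V i)))" if "i \<in> I" for i
  proof -
    have "V i \<subseteq> {[]}" using 0[OF that] by (auto simp: vecs_def)
    then consider "V i = {}" | "V i = {[]}" by (meson subset_singletonD)
    then show ?thesis by cases simp_all
  qed
  have fin: "finite (V i)" if "i \<in> I" for i
    using 0[OF that] by (rule finite_subset) (simp add: assms(2))
  have "card (zero_sum_tuples 0 I V) \<le> card (PiE I V)"
    unfolding zero_sum_tuples_def
    by (rule card_mono) (use assms(1) fin in \<open>auto intro!: finite_PiE\<close>)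
  also have "\<dots> = (\<Prod>i\<in>I. card (V i))" by (rule card_PiE[OF assms(1)])
  finally have "real (card (zero_sum_tuples 0 I V)) \<le> (\<Prod>i\<in>I. real (card (V i)))"
    unfolding of_nat_prod[symmetric] of_nat_le_iff .
  also have "\<dots> = (\<Prod>i\<in>I. sqrt (real (card (V i))))" using * by (rule prod.cong[OF refl])
  finally show ?case by simp
next
  case (Suc n)
  let ?K = "real (card I) ^ card I"
  let ?Z = "{\<alpha>. \<alpha> \<in> PiE I (\<lambda>_. A) \<and> even_fibers \<alpha> I}"
  let ?V = "\<lambda>i a. {t. a # t \<in> V i}"
  have fZ: "finite ?Z"
    by (rule finite_subset[of _ "PiE I (\<lambda>_. A)"]) (use assms in \<open>auto intro!: finite_PiE\<close>)
  have fV: "finite (V i)" if "i \<in> I" for i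
    using Suc.prems[OF that] by (rule finite_subset) (simp add: assms(2))
  have Vsub: "?V i a \<subseteq> vecs n A" if "i \<in> I" for i a
  proof
    fix t assume "t \<in> ?V i a"
    then have "a # t \<in> vecs (Suc n) A" using Suc.prems[OF that] by blast
    then show "t \<in> vecs n A" by (simp add: vecs_def)
  qed
  have fV': "finite (?V i a)" if "i \<in> I" for i a
    using Vsub[OF that] by (rule finite_subset) (simp add: assms(2))
  have "zero_sum_tuples (Suc n) I V
    \<subseteq> (\<Union>\<alpha>\<in>?Z. (\<lambda>y. \<lambda>i\<in>I. \<alpha> i # y i) ` zero_sum_tuples n I (\<lambda>i. ?V i (\<alpha> i)))"
  proof
    fix x assume x: "x \<in> zero_sum_tuples (Suc n) I V"
    have xv: "x i \<in> vecs (Suc n) A" "x i \<in> V i" if "i \<in> I" for i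
      using x Suc.prems[OF that] that by (auto simp: zero_sum_tuples_def)
    define \<alpha> where "\<alpha> = (\<lambda>i\<in>I. x i ! 0)"
    define y where "y = (\<lambda>i\<in>I. tl (x i))"
    have xe: "\<alpha> i # y i = x i" and \<alpha>A: "\<alpha> i \<in> A" if "i \<in> I" for i
      using xv(1)[OF that] that by (cases "x i"; auto simp: \<alpha>_def y_def vecs_def)+
    have z: "even_fibers (\<lambda>i. x i ! p) I" if "p < Suc n" for p
      using x that by (auto simp: zero_sum_tuples_def zero_sum_def)
    have "\<alpha> \<in> ?Z"
      using z[of 0] \<alpha>A by (auto simp: \<alpha>_def cong: even_fibers_cong)
    moreover have "even_fibers (\<lambda>i. y i ! p) I" if "p < n" for p
    proof -
      have "even_fibers (\<lambda>i. x i ! Suc p) I" using z that by blast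
      moreover have "x i ! Suc p = y i ! p" if "i \<in> I" for i using xe[OF that] by (metis nth_Cons_Suc)
      ultimately show ?thesis by (simp cong: even_fibers_cong)
    qed
    then have "y \<in> zero_sum_tuples n I (\<lambda>i. ?V i (\<alpha> i))"
      using xe xv(2) by (auto simp: zero_sum_tuples_def zero_sum_def y_def)
    moreover have "x = (\<lambda>i\<in>I. \<alpha> i # y i)"
    proof
      fix i show "x i = (\<lambda>i\<in>I. \<alpha> i # y i) i"
        using PiE_arb[of x I V i] x xe[of i] by (simp add: zero_sum_tuples_def)
    qed
    ultimately show "x \<in> (\<Union>\<alpha>\<in>?Z. (\<lambda>y. \<lambda>i\<in>I. \<alpha> i # y i) ` zero_sum_tuples n I (\<lambda>i. ?V i (\<alpha> i)))"
      by blast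
  qed
  then have "card (zero_sum_tuples (Suc n) I V)
    \<le> card (\<Union>\<alpha>\<in>?Z. (\<lambda>y. \<lambda>i\<in>I. \<alpha> i # y i) ` zero_sum_tuples n I (\<lambda>i. ?V i (\<alpha> i)))"
    using fZ fV' assms(1) by (intro card_mono finite_UN_I finite_imageI finite_zero_sum_tuples) auto
  also have "\<dots> \<le> (\<Sum>\<alpha>\<in>?Z. card (zero_sum_tuples n I (\<lambda>i. ?V i (\<alpha> i))))"
    using fZ fV' assms(1)
    by (intro order_trans[OF card_UN_le] sum_mono card_image_le finite_zero_sum_tuples) auto
  finally have "real (card (zero_sum_tuples (Suc n) I V))
    \<le> (\<Sum>\<alpha>\<in>?Z. real (card (zero_sum_tuples n I (\<lambda>i. ?V i (\<alpha> i)))))"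
    unfolding of_nat_sum[symmetric] of_nat_le_iff .
  also have "\<dots> \<le> (\<Sum>\<alpha>\<in>?Z. ?K ^ n * (\<Prod>i\<in>I. sqrt (real (card (?V i (\<alpha> i))))))"
    by (intro sum_mono Suc.IH Vsub)
  also have "\<dots> = ?K ^ n * (\<Sum>\<alpha>\<in>?Z. \<Prod>i\<in>I. sqrt (real (card (?V i (\<alpha> i)))))"
    by (simp add: sum_distrib_left)
  also have "\<dots> \<le> ?K ^ n * (?K * (\<Prod>i\<in>I. L2_set (\<lambda>a. sqrt (real (card (?V i a)))) A))"
    using assms by (intro mult_left_mono sum_even_fibers_le) auto
  also have "\<dots> \<le> ?K ^ n * (?K * (\<Prod>i\<in>I. sqrt (real (card (V i)))))"
  proof (intro mult_left_mono prod_mono conjI)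
    fix i assume i: "i \<in> I"
    have "(\<Sum>a\<in>A. card (?V i a)) = (\<Sum>a\<in>A. card ((#) a ` ?V i a))"
      by (intro sum.cong refl card_image[symmetric]) (auto simp: inj_on_def)
    also have "\<dots> = card (\<Union>a\<in>A. (#) a ` ?V i a)"
      using assms(2) fV' i by (intro card_UN_disjoint[symmetric]) auto
    also have "\<dots> \<le> card (V i)" using fV[OF i] by (intro card_mono) auto
    finally have "(\<Sum>a\<in>A. real (card (?V i a))) \<le> real (card (V i))"
      unfolding of_nat_sum[symmetric] of_nat_le_iff .
    then show "L2_set (\<lambda>a. sqrt (real (card (?V i a)))) A \<le> sqrt (real (card (V i)))"
      by (simp add: L2_set_def)
  qed auto
  finally show ?case by (simp add: mult_ac)
qed

lemma card_zero_sum_tuples_reindex: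
  assumes "finite I" "bij_betw \<phi> I J" "\<And>j. j \<in> J \<Longrightarrow> finite (V j)"
  shows "card (zero_sum_tuples n J V) \<le> card (zero_sum_tuples n I (\<lambda>i. V (\<phi> i)))"
proof (rule card_inj_on_le[where f = "\<lambda>x. \<lambda>i\<in>I. x (\<phi> i)"])
  have \<phi>: "\<phi> ` I = J" using assms(2) by (simp add: bij_betw_def)
  show "finite (zero_sum_tuples n I (\<lambda>i. V (\<phi> i)))"
    using assms \<phi> by (intro finite_zero_sum_tuples) auto
  show "inj_on (\<lambda>x. \<lambda>i\<in>I. x (\<phi> i)) (zero_sum_tuples n J V)"
  proof (rule inj_onI)
    fix x y assume x: "x \<in> zero_sum_tuples n J V" and y: "y \<in> zero_sum_tuples n J V"
      and eq: "(\<lambda>i\<in>I. x (\<phi> i)) = (\<lambda>i\<in>I. y (\<phi> i))"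
    have "x j = y j" if jJ: "j \<in> J" for j
    proof -
      obtain i where i: "i \<in> I" "j = \<phi> i" using jJ \<phi> by blast
      show ?thesis using fun_cong[OF eq, of i] i by simp
    qed
    then show "x = y"
      using x y by (intro PiE_ext[of x J V y]) (simp_all add: zero_sum_tuples_def)
  qed
  show "(\<lambda>x. \<lambda>i\<in>I. x (\<phi> i)) ` zero_sum_tuples n J V \<subseteq> zero_sum_tuples n I (\<lambda>i. V (\<phi> i))"
  proof (rule image_subsetI)
    fix x assume x: "x \<in> zero_sum_tuples n J V"
    have "even_fibers (\<lambda>i. (\<lambda>i\<in>I. x (\<phi> i)) i ! p) I" if p: "p < n" for p
      unfolding even_fibers_def
    proof
      fix a
      have "{j \<in> J. x j ! p = a} = \<phi> ` {i \<in> I. (\<lambda>i\<in>I. x (\<phi> i)) i ! p = a}"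
        using \<phi> by auto
      moreover have "inj_on \<phi> {i \<in> I. (\<lambda>i\<in>I. x (\<phi> i)) i ! p = a}"
        using assms(2) by (auto simp: bij_betw_def inj_on_def)
      moreover have "even (card {j \<in> J. x j ! p = a})"
        using x p by (simp add: zero_sum_tuples_def zero_sum_def even_fibers_def)
      ultimately show "even (card {i \<in> I. (\<lambda>i\<in>I. x (\<phi> i)) i ! p = a})"
        by (simp add: card_image)
    qed
    moreover have "(\<lambda>i\<in>I. x (\<phi> i)) \<in> PiE I (\<lambda>i. V (\<phi> i))"
      using x \<phi> by (auto simp: zero_sum_tuples_def)
    ultimately show "(\<lambda>i\<in>I. x (\<phi> i)) \<in> zero_sum_tuples n I (\<lambda>i. V (\<phi> i))"
      by (simp add: zero_sum_tuples_def zero_sum_def)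
  qed
qed

lemma card_zero_sum_subtuples_le:
  assumes "finite I" "J \<subseteq> I" "\<And>i. i \<in> I \<Longrightarrow> finite (V i)"
  shows "card {x \<in> PiE I V. zero_sum n x J} \<le> card (zero_sum_tuples n J V) * (\<Prod>i\<in>I - J. card (V i))"
proof -
  let ?B = "zero_sum_tuples n J V \<times> PiE (I - J) V"
  have fJ: "finite J" using assms finite_subset by blast
  have "card {x \<in> PiE I V. zero_sum n x J} \<le> card ?B"
  proof (rule card_inj_on_le[where f = "\<lambda>x. (restrict x J, restrict x (I - J))"])
    show "inj_on (\<lambda>x. (restrict x J, restrict x (I - J))) {x \<in> PiE I V. zero_sum n x J}"
    proof (rule inj_onI)
      fix x y assume x: "x \<in> {x \<in> PiE I V. zero_sum n x J}" and y: "y \<in> {x \<in> PiE I V. zero_sum n x J}"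
        and eq: "(restrict x J, restrict x (I - J)) = (restrict y J, restrict y (I - J))"
      have "x i = y i" if "i \<in> I" for i
        using eq that by (cases "i \<in> J") (metis Pair_inject restrict_apply DiffI)+
      then show "x = y" using x y by (intro PiE_ext[of x I V y]) simp_all
    qed
    show "(\<lambda>x. (restrict x J, restrict x (I - J))) ` {x \<in> PiE I V. zero_sum n x J} \<subseteq> ?B"
    proof (rule image_subsetI)
      fix x assume x: "x \<in> {x \<in> PiE I V. zero_sum n x J}"
      have "zero_sum n (restrict x J) J" using x by (subst zero_sum_cong[of _ _ x]) auto
      then show "(restrict x J, restrict x (I - J)) \<in> ?B"
        using x assms(2) by (auto simp: zero_sum_tuples_def)
    qed
    show "finite ?B"
      using assms fJ by (intro finite_cartesian_product finite_zero_sum_tuples finite_PiE) auto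
  qed
  also have "\<dots> = card (zero_sum_tuples n J V) * (\<Prod>i\<in>I - J. card (V i))"
    using assms by (simp add: card_cartesian_product card_PiE)
  finally show ?thesis .
qed

text \<open>
  Up to the factor \<open>4 ^ t\<close>, the bound in \<open>good_key\<close> is the average over all keys of \<open>W\<close>. That
  factor makes the proportion of keys violating it, summed over all \<open>t \<ge> 1\<close>, less than one.
\<close>

definition tuple_factor :: "nat \<Rightarrow> nat \<Rightarrow> real" where
  "tuple_factor n t = 4 ^ t * (real (2 * t) ^ (2 * t)) ^ n"

definition good_key :: "nat \<Rightarrow> nat \<Rightarrow> 'a list \<Rightarrow> 'a list set \<Rightarrow> bool" where
  "good_key n N x0 W \<longleftrightarrow> (\<forall>t\<in>{1..N}.
     real (card (zero_sum_tuples n {..<2 * t} (\<lambda>i. if i = 0 then {x0} else W)))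
       \<le> tuple_factor n t * real (card W) ^ (t - 1))"

lemma tuple_factor_pos: "t \<ge> 1 \<Longrightarrow> tuple_factor n t > 0"
  by (simp add: tuple_factor_def)

lemma card_zero_sum_tuples_const_le:
  assumes "finite J" "card J = 2 * t" "finite A" "W \<subseteq> vecs n A" "\<And>i. i \<in> J \<Longrightarrow> V i = W"
  shows "real (card (zero_sum_tuples n J V)) \<le> (real (2 * t) ^ (2 * t)) ^ n * real (card W) ^ t"
proof -
  have "(\<Prod>i\<in>J. sqrt (real (card (V i)))) = sqrt (real (card W)) ^ (2 * t)"
    using assms by simp
  also have "\<dots> = real (card W) ^ t" by (simp add: power_mult)
  finally show ?thesis
    using card_zero_sum_tuples_le[of J A V n] assms by simp
qed

text \<open>Markov's inequality for each \<open>t\<close>: tuples pinned at different keys are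
  disjoint, so the pinned counts sum to at most the unpinned count, and at most a fraction
  \<open>(1 / 4) ^ t\<close> of the keys exceeds the bound for \<open>t\<close>.\<close>

lemma exists_good_key:
  assumes "finite A" "W \<subseteq> vecs n A" "W \<noteq> {}"
  shows "\<exists>x0\<in>W. good_key n N x0 W"
proof (rule ccontr)
  assume bad: "\<not> ?thesis"
  let ?Z = "\<lambda>t x0. zero_sum_tuples n {..<2 * t} (\<lambda>i. if i = 0 then {x0} else W)"
  let ?B = "\<lambda>t. tuple_factor n t * real (card W) ^ (t - 1)"
  have fW: "finite W" using assms(2) by (rule finite_subset) (simp add: assms(1))
  then have W: "real (card W) > 0" using assms(3) by (simp add: card_gt_0_iff)
  then have B: "?B t > 0" if "t \<in> {1..N}" for t using that by (simp add: tuple_factor_pos)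
  have le: "(\<Sum>x0\<in>W. real (card (?Z t x0)) / ?B t) \<le> real (card W) * (1 / 4) ^ t"
    if t: "t \<in> {1..N}" for t
  proof -
    have fZ: "finite (?Z t x0)" for x0 by (rule finite_zero_sum_tuples) (use fW in auto)
    have "(\<Sum>x0\<in>W. card (?Z t x0)) = card (\<Union>x0\<in>W. ?Z t x0)"
    proof (rule card_UN_disjoint[symmetric])
      have "x 0 = x0" if "x \<in> ?Z t x0" for x x0
      proof -
        have "x 0 \<in> (if 0 = 0 then {x0} else W)"
          using PiE_mem[of x "{..<2 * t}" "\<lambda>i. if i = 0 then {x0} else W" 0] that t
          by (simp add: zero_sum_tuples_def)
        then show ?thesis by simp
      qed
      then show "\<forall>i\<in>W. \<forall>j\<in>W. i \<noteq> j \<longrightarrow> ?Z t i \<inter> ?Z t j = {}" by blast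
    qed (use fW fZ in auto)
    also have "\<dots> \<le> card (zero_sum_tuples n {..<2 * t} (\<lambda>_. W))"
    proof (intro card_mono finite_zero_sum_tuples)
      show "(\<Union>x0\<in>W. ?Z t x0) \<subseteq> zero_sum_tuples n {..<2 * t} (\<lambda>_. W)"
      proof (rule UN_least)
        fix x0 assume "x0 \<in> W"
        then have "PiE {..<2 * t} (\<lambda>i. if i = 0 then {x0} else W) \<subseteq> PiE {..<2 * t} (\<lambda>_. W)"
          by (intro PiE_mono) simp
        then show "?Z t x0 \<subseteq> zero_sum_tuples n {..<2 * t} (\<lambda>_. W)"
          unfolding zero_sum_tuples_def by blast
      qed
    qed (use fW in auto)
    finally have "real (\<Sum>x0\<in>W. card (?Z t x0)) \<le> real (card (zero_sum_tuples n {..<2 * t} (\<lambda>_. W)))"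
      by (rule of_nat_mono)
    also have "\<dots> \<le> (real (2 * t) ^ (2 * t)) ^ n * real (card W) ^ t"
      by (rule card_zero_sum_tuples_const_le) (use assms in auto)
    also have "\<dots> = real (card W) * (1 / 4) ^ t * ?B t"
      using t by (cases t) (simp_all add: tuple_factor_def power_divide)
    finally show ?thesis using B[OF t]
      by (simp add: sum_divide_distrib[symmetric] pos_divide_le_eq)
  qed
  have "real (card W) = (\<Sum>x0\<in>W. 1)" by simp
  \<comment> \<open>If no key is good, every key has some \<open>t\<close> whose ratio of count to
    bound exceeds 1.\<close>
  also have "\<dots> < (\<Sum>x0\<in>W. \<Sum>t\<in>{1..N}. real (card (?Z t x0)) / ?B t)"
  proof (rule sum_strict_mono[OF fW assms(3)])
    fix x0 assume "x0 \<in> W"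
    then have "\<not> good_key n N x0 W" using bad by blast
    then obtain t where t: "t \<in> {1..N}" "real (card (?Z t x0)) > ?B t"
      unfolding good_key_def not_le[symmetric] by blast
    have "1 < real (card (?Z t x0)) / ?B t" using t(2) B[OF t(1)] by (simp add: less_divide_eq)
    also have "\<dots> \<le> (\<Sum>t\<in>{1..N}. real (card (?Z t x0)) / ?B t)"
      using t(1) B by (intro member_le_sum) (simp_all add: less_imp_le)
    finally show "1 < (\<Sum>t\<in>{1..N}. real (card (?Z t x0)) / ?B t)" .
  qed
  also have "\<dots> = (\<Sum>t\<in>{1..N}. \<Sum>x0\<in>W. real (card (?Z t x0)) / ?B t)" by (rule sum.swap)
  also have "\<dots> \<le> (\<Sum>t\<in>{1..N}. real (card W) * (1 / 4) ^ t)" by (rule sum_mono) (rule le)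
  also have "\<dots> = real (card W) * (\<Sum>t\<in>{1..N}. (1 / 4) ^ t)" by (simp add: sum_distrib_left)
  also have "\<dots> \<le> real (card W) * 1"
  proof (intro mult_left_mono)
    \<comment> \<open>The subtracted power leaves room for the next term in the induction.\<close>
    have "(\<Sum>t\<in>{1..N}. (1 / 4) ^ t) \<le> (1 :: real) - (1 / 4) ^ N"
    proof (induction N)
      case (Suc N)
      have "(\<Sum>t\<in>{1..Suc N}. (1 / 4) ^ t) = (\<Sum>t\<in>{1..N}. (1 / 4) ^ t) + (1 / 4 :: real) ^ Suc N"
        by simp
      moreover have "(1 / 4 :: real) ^ N \<ge> 0" by simp
      ultimately show ?case using Suc unfolding power_Suc by linarith
    qed simp
    then show "(\<Sum>t\<in>{1..N}. (1 / 4) ^ t) \<le> (1 :: real)"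
      by (rule order_trans) simp
  qed simp
  finally show False by simp
qed

text \<open>A key satisfying \<open>P\<close> relative to the remaining set is removed repeatedly,
  as in a degeneracy ordering of a graph. \<open>later x\<close> is the set remaining just before
  \<open>x\<close> is removed; the member of \<open>Y\<close> removed first still sees all of
  \<open>Y\<close>.\<close>

lemma exists_elimination_order:
  assumes "finite V" and "\<And>W. W \<subseteq> V \<Longrightarrow> W \<noteq> {} \<Longrightarrow> \<exists>x\<in>W. P x W"
  shows "\<exists>later. (\<forall>x\<in>V. later x \<subseteq> V \<and> x \<in> later x \<and> P x (later x)) \<and>
    (\<forall>Y. Y \<subseteq> V \<longrightarrow> Y \<noteq> {} \<longrightarrow> (\<exists>x\<in>Y. Y \<subseteq> later x))"
  using assms
proof (induction V rule: finite_psubset_induct)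
  case (psubset V)
  show ?case
  proof (cases "V = {}")
    case False
    then obtain x where x: "x \<in> V" "P x V" using psubset.prems by blast
    have "\<exists>later. (\<forall>y\<in>V - {x}. later y \<subseteq> V - {x} \<and> y \<in> later y \<and> P y (later y)) \<and>
      (\<forall>Y. Y \<subseteq> V - {x} \<longrightarrow> Y \<noteq> {} \<longrightarrow> (\<exists>y\<in>Y. Y \<subseteq> later y))"
      by (rule psubset.IH) (use x psubset.prems in auto)
    then obtain later where l: "\<And>y. y \<in> V - {x} \<Longrightarrow> later y \<subseteq> V - {x} \<and> y \<in> later y \<and> P y (later y)"
      "\<And>Y. Y \<subseteq> V - {x} \<Longrightarrow> Y \<noteq> {} \<Longrightarrow> \<exists>y\<in>Y. Y \<subseteq> later y" by blast
    have "\<exists>y\<in>Y. Y \<subseteq> (later(x := V)) y" if Y: "Y \<subseteq> V" "Y \<noteq> {}" for Y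
    proof (cases "x \<in> Y")
      case True
      then show ?thesis using Y by auto
    next
      case False
      then show ?thesis using l(2)[of Y] Y by fastforce
    qed
    moreover have "\<forall>y\<in>V. (later(x := V)) y \<subseteq> V \<and> y \<in> (later(x := V)) y \<and> P y ((later(x := V)) y)"
    proof
      fix y assume "y \<in> V"
      then show "(later(x := V)) y \<subseteq> V \<and> y \<in> (later(x := V)) y \<and> P y ((later(x := V)) y)"
        using x l(1)[of y] by (cases "y = x") auto
    qed
    ultimately show ?thesis by blast
  qed auto
qed

text \<open>If the pinned position lies in \<open>J\<close>, goodness bounds the tuples on
  \<open>J\<close> and \<open>q + 1 - 2 * t\<close> positions are free. Otherwise the unpinned count
  has one more factor \<open>card W\<close>, but one position outside \<open>J\<close> is the pinned
  one and has a single choice. The exponent is \<open>q - t\<close> both times.\<close>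

lemma card_pinned_zero_sum_tuples_le:
  assumes good: "good_key n N x0 W" and fin: "finite A" and W: "W \<subseteq> vecs n A" "x0 \<in> W"
    and J: "J \<subseteq> {..q}" "card J = 2 * t" "t \<in> {1..N}"
  shows "real (card {x \<in> PiE {..q} (\<lambda>i. if i = 0 then {x0} else W). zero_sum n x J})
    \<le> tuple_factor n t * real (card W) ^ (q - t)"
proof -
  let ?U = "\<lambda>i. if i = 0 then {x0} else W"
  have fW: "finite W" using W(1) by (rule finite_subset) (simp add: fin)
  have fJ: "finite J" using J(1) by (rule finite_subset) simp
  have "card J \<le> card {..q}" using J(1) by (intro card_mono) auto
  then have tq: "2 * t \<le> q + 1" using J(2) by simp
  have W1: "real (card W) \<ge> 1" using W(2) fW by (simp add: Suc_le_eq card_gt_0_iff) blast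
  have "card {x \<in> PiE {..q} ?U. zero_sum n x J}
    \<le> card (zero_sum_tuples n J ?U) * (\<Prod>i\<in>{..q} - J. card (?U i))"
    using J(1) fW by (intro card_zero_sum_subtuples_le) auto
  then have "real (card {x \<in> PiE {..q} ?U. zero_sum n x J})
    \<le> real (card (zero_sum_tuples n J ?U)) * real (\<Prod>i\<in>{..q} - J. card (?U i))"
    unfolding of_nat_mult[symmetric] of_nat_le_iff .
  also have "\<dots> \<le> tuple_factor n t * real (card W) ^ (q - t)"
  proof (cases "0 \<in> J")
    case True
    \<comment> \<open>\<open>good_key\<close> pins position 0, so the relabelling of
      \<open>J\<close> must fix 0; \<open>\<psi>\<close> matches the remaining positions
      arbitrarily.\<close>
    have "card ({..<2 * t} - {0}) = card (J - {0})" using J True fJ by simp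
    then obtain \<psi> where \<psi>: "bij_betw \<psi> ({..<2 * t} - {0}) (J - {0})"
      using finite_same_card_bij fJ by (metis finite_Diff finite_lessThan)
    define \<phi> where "\<phi> = \<psi>(0 := 0)"
    have "bij_betw \<phi> ({..<2 * t} - {0}) (J - {0})"
      using \<psi> by (subst bij_betw_cong[of _ _ \<psi>]) (auto simp: \<phi>_def)
    then have "bij_betw \<phi> (({..<2 * t} - {0}) \<union> {0}) ((J - {0}) \<union> {\<phi> 0})"
      by (intro notIn_Un_bij_betw) (auto simp: \<phi>_def)
    moreover have "({..<2 * t} - {0}) \<union> {0} = {..<2 * t}" using J(3) by auto
    moreover have "(J - {0}) \<union> {\<phi> 0} = J" using True by (auto simp: \<phi>_def)
    ultimately have \<phi>: "bij_betw \<phi> {..<2 * t} J" by simp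
    have \<phi>0: "\<phi> i = 0 \<longleftrightarrow> i = 0" if "i < 2 * t" for i
    proof -
      have "\<phi> i = \<phi> 0 \<longleftrightarrow> i = 0"
        using bij_betw_imp_inj_on[OF \<phi>] that by (intro inj_on_eq_iff) auto
      then show ?thesis by (simp add: \<phi>_def)
    qed
    have "card (zero_sum_tuples n J ?U) \<le> card (zero_sum_tuples n {..<2 * t} (\<lambda>i. ?U (\<phi> i)))"
      using fW \<phi> by (intro card_zero_sum_tuples_reindex) auto
    also have "zero_sum_tuples n {..<2 * t} (\<lambda>i. ?U (\<phi> i)) = zero_sum_tuples n {..<2 * t} ?U"
    proof -
      have "PiE {..<2 * t} (\<lambda>i. ?U (\<phi> i)) = PiE {..<2 * t} ?U"
        by (rule PiE_cong) (simp add: \<phi>0)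
      then show ?thesis by (simp only: zero_sum_tuples_def)
    qed
    finally have "real (card (zero_sum_tuples n J ?U)) \<le> tuple_factor n t * real (card W) ^ (t - 1)"
      using good J(3) unfolding good_key_def by (meson of_nat_mono order_trans)
    moreover have "real (\<Prod>i\<in>{..q} - J. card (?U i)) = real (card W) ^ (q + 1 - 2 * t)"
    proof -
      have "(\<Prod>i\<in>{..q} - J. card (?U i)) = (\<Prod>i\<in>{..q} - J. card W)"
        using True by (intro prod.cong) auto
      then show ?thesis using J fJ by (simp add: card_Diff_subset)
    qed
    moreover have "real (card W) ^ (t - 1) * real (card W) ^ (q + 1 - 2 * t) = real (card W) ^ (q - t)"
    proof -
      have "t - 1 + (q + 1 - 2 * t) = q - t" using tq J(3) by auto
      then show ?thesis by (simp flip: power_add)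
    qed
    ultimately show ?thesis
      using mult_right_mono[of "real (card (zero_sum_tuples n J ?U))"
          "tuple_factor n t * real (card W) ^ (t - 1)" "real (card W) ^ (q + 1 - 2 * t)"]
      by (simp only: mult.assoc)
  next
    case False
    have "J \<subseteq> {..q} - {0}" using J(1) False by auto
    then have "card J \<le> card ({..q} - {0})" by (intro card_mono) auto
    then have tq': "2 * t \<le> q" using J(2) by simp
    have "real (card (zero_sum_tuples n J ?U)) \<le> (real (2 * t) ^ (2 * t)) ^ n * real (card W) ^ t"
      by (rule card_zero_sum_tuples_const_le[of J t A W]) (use fJ J fin W False in auto)
    also have "\<dots> \<le> tuple_factor n t * real (card W) ^ t"
      using mult_right_mono[of 1 "4 ^ t" "(real (2 * t) ^ (2 * t)) ^ n * real (card W) ^ t"]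
      unfolding tuple_factor_def mult.assoc by simp
    finally have "real (card (zero_sum_tuples n J ?U)) \<le> tuple_factor n t * real (card W) ^ t" .
    moreover have "real (\<Prod>i\<in>{..q} - J. card (?U i)) = real (card W) ^ (q - 2 * t)"
    proof -
      have "(\<Prod>i\<in>{..q} - J. card (?U i)) = (\<Prod>i\<in>{..q} - J - {0}. card (?U i))"
        using False by (subst prod.remove[of _ 0]) auto
      also have "\<dots> = (\<Prod>i\<in>{..q} - J - {0}. card W)" by (intro prod.cong) auto
      also have "\<dots> = card W ^ (q - 2 * t)" using J fJ False by (simp add: card_Diff_subset)
      finally show ?thesis by simp
    qed
    moreover have "real (card W) ^ t * real (card W) ^ (q - 2 * t) = real (card W) ^ (q - t)"
    proof -
      have "t + (q - 2 * t) = q - t" using tq' by auto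
      then show ?thesis by (simp flip: power_add)
    qed
    ultimately show ?thesis
      using mult_right_mono[of "real (card (zero_sum_tuples n J ?U))"
          "tuple_factor n t * real (card W) ^ t" "real (card W) ^ (q - 2 * t)"]
      by (simp only: mult.assoc)
  qed
  finally show ?thesis .
qed

subsection \<open>Alternating walks\<close>

lemma even_fibers_imp_even_card:
  assumes "finite I" "even_fibers f I"
  shows "even (card I)"
proof -
  have "card I = (\<Sum>a\<in>f ` I. card {i \<in> I. f i = a})"
    using sum.image_gen[OF assms(1), of "\<lambda>_. 1 :: nat" f] by simp
  then show ?thesis using assms(2) by (simp add: even_fibers_def dvd_sum)
qed

text \<open>A perfect matching inside the fibers, built pair by pair and encoded as an involution
  without fixed points.\<close>

lemma even_fibers_involution:
  assumes "finite Y" "even_fibers f Y"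
  shows "\<exists>\<pi>. \<forall>y\<in>Y. \<pi> y \<in> Y \<and> \<pi> y \<noteq> y \<and> \<pi> (\<pi> y) = y \<and> f (\<pi> y) = f y"
  using assms
proof (induction Y rule: finite_psubset_induct)
  case (psubset Y)
  show ?case
  proof (cases "Y = {}")
    case False
    then obtain u where u: "u \<in> Y" by blast
    obtain v where v: "v \<in> Y" "v \<noteq> u" "f v = f u"
      using even_fibers_obtain_partner[OF psubset.hyps(1) psubset.prems u] by blast
    have "even_fibers f (Y - {u, v})"
      using psubset u v by (intro even_fibers_remove_pair) auto
    then obtain \<pi> where \<pi>: "\<And>y. y \<in> Y - {u, v} \<Longrightarrow>
        \<pi> y \<in> Y - {u, v} \<and> \<pi> y \<noteq> y \<and> \<pi> (\<pi> y) = y \<and> f (\<pi> y) = f y"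
      using psubset.IH[of "Y - {u, v}"] u by blast
    let ?\<pi> = "\<pi>(u := v, v := u)"
    have "?\<pi> y \<in> Y \<and> ?\<pi> y \<noteq> y \<and> ?\<pi> (?\<pi> y) = y \<and> f (?\<pi> y) = f y" if "y \<in> Y" for y
    proof (cases "y = u \<or> y = v")
      case True
      then show ?thesis using u v by auto
    next
      case False
      then show ?thesis using \<pi>[of y] that by auto
    qed
    then show ?thesis by blast
  qed simp
qed

lemma zero_sum_pair_iff:
  assumes "i \<noteq> j" "length (x i) = n" "length (x j) = n"
  shows "zero_sum n x {i, j} \<longleftrightarrow> x i = x j"
proof
  assume z: "zero_sum n x {i, j}"
  show "x i = x j"
  proof (rule nth_equalityI)
    fix p assume "p < length (x i)"
    then have "even_fibers (\<lambda>l. x l ! p) {i, j}" using z assms by (simp add: zero_sum_def)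
    then obtain l where "l \<in> {i, j}" "l \<noteq> i" "x l ! p = x i ! p"
      using even_fibers_obtain_partner[of "{i, j}" "\<lambda>l. x l ! p" i] by blast
    then show "x i ! p = x j ! p" by auto
  qed (use assms in simp)
next
  assume eq: "x i = x j"
  show "zero_sum n x {i, j}"
    unfolding zero_sum_def even_fibers_def
  proof (intro allI impI)
    fix p a
    have "{l \<in> {i, j}. x l ! p = a} = (if x i ! p = a then {i, j} else {})" using eq by auto
    then show "even (card {l \<in> {i, j}. x l ! p = a})" using assms(1) by simp
  qed
qed

definition alternating_walk :: "('k \<Rightarrow> 'b) \<Rightarrow> ('k \<Rightarrow> 'b) \<Rightarrow> (nat \<Rightarrow> 'k) \<Rightarrow> nat \<Rightarrow> bool" where
  "alternating_walk f g x q \<longleftrightarrow>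
     (\<forall>i<q. (even i \<longrightarrow> f (x (Suc i)) = f (x i)) \<and> (odd i \<longrightarrow> g (x (Suc i)) = g (x i)))"

text \<open>
  If the colourings \<open>f\<close> and \<open>g\<close> have even fibers on \<open>Y\<close>, perfect matchings inside the fibers of
  \<open>f\<close> and of \<open>g\<close> split \<open>Y\<close> into alternating cycles. The cycle of \<open>x0\<close> is followed until the keys
  become dependent; the first repeated key can only be \<open>x0\<close> itself.
\<close>

lemma alternating_walk_cases:
  fixes f g :: "'a list \<Rightarrow> 'b"
  assumes Y: "finite Y" "even_fibers f Y" "even_fibers g Y" "x0 \<in> Y" "Y \<subseteq> vecs n A" and n: "n \<ge> 1"
  obtains x where "x 0 = x0" "\<And>i. x i \<in> Y" "\<And>q. alternating_walk f g x q"
    "independent_keys n x {..N} \<or> (\<exists>q\<in>{1..N}. independent_keys n x {..<q} \<and>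
       ((even q \<and> g (x (q - 1)) = g (x 0)) \<or>
        (\<exists>J\<subseteq>{..q}. zero_sum n x J \<and> even (card J) \<and> card J \<ge> 4)))"
proof -
  obtain \<pi> where \<pi>: "\<And>y. y \<in> Y \<Longrightarrow> \<pi> y \<in> Y \<and> \<pi> y \<noteq> y \<and> \<pi> (\<pi> y) = y \<and> f (\<pi> y) = f y"
    using even_fibers_involution[OF Y(1,2)] by blast
  obtain \<rho> where \<rho>: "\<And>y. y \<in> Y \<Longrightarrow> \<rho> y \<in> Y \<and> \<rho> y \<noteq> y \<and> \<rho> (\<rho> y) = y \<and> g (\<rho> y) = g y"
    using even_fibers_involution[OF Y(1,3)] by blast
  define \<sigma> where "\<sigma> i = (if even i then \<pi> else \<rho>)" for i :: nat
  have \<sigma>: "\<sigma> i y \<in> Y" "\<sigma> i y \<noteq> y" "\<sigma> i (\<sigma> i y) = y" if "y \<in> Y" for i y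
    using \<pi>[OF that] \<rho>[OF that] by (auto simp: \<sigma>_def)
  define x where "x = rec_nat x0 \<sigma>"
  have x0: "x 0 = x0" and xS: "\<And>i. x (Suc i) = \<sigma> i (x i)" by (simp_all add: x_def)
  have xY: "x i \<in> Y" for i by (induction i) (use Y(4) \<sigma> in \<open>auto simp: x0 xS\<close>)
  have len: "length (x i) = n" for i using xY[of i] Y(5) by (auto simp: vecs_def)
  have rev: "\<sigma> i (x (Suc i)) = x i" for i using \<sigma>(3)[OF xY] by (simp add: xS)
  have walk: "alternating_walk f g x q" for q
    unfolding alternating_walk_def using \<pi>[OF xY] \<rho>[OF xY] by (simp add: xS \<sigma>_def)
  have "\<exists>q\<in>{1..N}. independent_keys n x {..<q} \<and> ((even q \<and> g (x (q - 1)) = g (x 0)) \<or>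
        (\<exists>J\<subseteq>{..q}. zero_sum n x J \<and> even (card J) \<and> card J \<ge> 4))"
    if dep: "\<not> independent_keys n x {..N}"
  proof -
    \<comment> \<open>The first index that makes the walk dependent. By minimality every dependency
      within \<open>{..q}\<close> contains \<open>q\<close>.\<close>
    define q where "q = (LEAST q. \<not> independent_keys n x {..q})"
    have q: "\<not> independent_keys n x {..q}" unfolding q_def by (rule LeastI[of _ N]) (rule dep)
    have qN: "q \<le> N" unfolding q_def by (rule Least_le) (rule dep)
    have ind: "independent_keys n x {..<q}"
    proof (cases q)
      case 0
      then show ?thesis by (auto simp: independent_keys_def)
    next
      case (Suc p)
      then show ?thesis using not_less_Least[of p "\<lambda>q. \<not> independent_keys n x {..q}"]
        by (simp add: q_def lessThan_Suc_atMost)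
    qed
    obtain J where J: "J \<subseteq> {..q}" "J \<noteq> {}" "zero_sum n x J"
      using q by (auto simp: independent_keys_def)
    have fJ: "finite J" using J(1) by (rule finite_subset) simp
    have qJ: "q \<in> J"
    proof (rule ccontr)
      assume "q \<notin> J"
      then have "J \<subseteq> {..<q}" using J(1) by (force simp: le_less)
      then show False using ind J by (auto simp: independent_keys_def)
    qed
    \<comment> \<open>A single coordinate suffices for the parity of \<open>card J\<close>; it
      exists because \<open>n \<ge> 1\<close>.\<close>
    have "even_fibers (\<lambda>i. x i ! 0) J" using J(3) n by (simp add: zero_sum_def)
    then have ev: "even (card J)" using fJ by (rule even_fibers_imp_even_card[rotated])
    have "card J \<noteq> 0" using J fJ by simp
    with ev have c2: "card J \<ge> 2" by (metis One_nat_def Suc_1 less_2_cases_iff not_less odd_one)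
    have q1: "q \<ge> 1"
    proof (rule ccontr)
      assume "\<not> q \<ge> 1"
      then have "card J \<le> card {0 :: nat}" using J(1) by (intro card_mono) auto
      then show False using c2 by simp
    qed
    have "(even q \<and> g (x (q - 1)) = g (x 0)) \<or>
        (\<exists>J\<subseteq>{..q}. zero_sum n x J \<and> even (card J) \<and> card J \<ge> 4)"
    proof (cases "card J = 2")
      case False
      then have "card J \<ge> 4" using ev c2 by presburger
      then show ?thesis using J ev by blast
    next
      case True
      then have "card (J - {q}) = 1" using qJ fJ by simp
      then obtain j where "J - {q} = {j}" by (auto simp: card_1_singleton_iff)
      then have j: "J = {q, j}" "j \<noteq> q" using qJ by auto
      then have jq: "j < q" using J(1) by auto
      have xq: "x q = x j" using J(3) j len zero_sum_pair_iff[of q j x n] by simp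
      have dist: "x a \<noteq> x b" if "a < q" "b < q" "a \<noteq> b" for a b
        using ind that len zero_sum_pair_iff[of a b x n] unfolding independent_keys_def by auto
      obtain q' where q': "q = Suc q'" using q1 by (cases q) auto
      have xq': "x q' = \<sigma> q' (x j)" using rev[of q'] xq q' by simp
      \<comment> \<open>If steps \<open>q'\<close> and \<open>j\<close> used the same matching, the
        partner of \<open>x q = x j\<close> would be both \<open>x q'\<close> and
        \<open>x (Suc j)\<close>. This repeats an earlier key or, if \<open>Suc j = q\<close>, gives
        a fixed point.\<close>
      have differ: "even q' \<noteq> even j"
      proof
        assume same: "even q' = even j"
        then have eq: "x q' = x (Suc j)" using xq' by (simp add: xS \<sigma>_def)
        show False
        proof (cases "Suc j = q")
          case True
          then show False using xq \<sigma>(2)[OF xY, of j j] by (auto simp: xS)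
        next
          case False
          moreover have "q' \<noteq> Suc j" using same by auto
          ultimately show False using dist[of q' "Suc j"] jq eq q' by simp
        qed
      qed
      \<comment> \<open>Otherwise the step into \<open>x j\<close> uses the same matching as the
        step into \<open>x q\<close>, so the predecessors \<open>x j'\<close> and
        \<open>x q'\<close> agree although both indices are below \<open>q\<close>.\<close>
      have "j = 0"
      proof (rule ccontr)
        assume "j \<noteq> 0"
        then obtain j' where j': "j = Suc j'" by (cases j) auto
        have "x q' = x j'" using xq' differ rev[of j'] by (simp add: j' \<sigma>_def)
        then show False using dist[of q' j'] jq q' j' by simp
      qed
      then have "even q" "g (x (q - 1)) = g (x 0)"
        using differ q' xq walk[of q] by (auto simp: alternating_walk_def)
      then show ?thesis by blast
    qed
    then show ?thesis using ind qN q1 by (intro bexI[of _ q]) auto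
  qed
  then show thesis using that[of x] x0 xY walk by blast
qed

subsection \<open>Random tables\<close>

lemma measure_pmf_prob_Times:
  "measure_pmf.prob (pair_pmf M N) (A \<times> B) = measure_pmf.prob M A * measure_pmf.prob N B"
proof -
  have "measure_pmf.prob (pair_pmf M N) (A \<times> B)
    = measure_pmf.prob (pair_pmf M N) ((A \<inter> set_pmf M) \<times> (B \<inter> set_pmf N))"
    by (rule measure_prob_cong_0) (auto simp: pmf_pair set_pmf_iff)
  also have "\<dots> = measure_pmf.prob M (A \<inter> set_pmf M) * measure_pmf.prob N (B \<inter> set_pmf N)"
    by (rule measure_pmf_prob_product) auto
  finally show ?thesis by (simp add: measure_Int_set_pmf)
qed

lemma measure_pmf_union_bound:
  assumes "finite X" "\<And>x. x \<in> X \<Longrightarrow> measure_pmf.prob p {t. Q x t} \<le> b"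
  shows "measure_pmf.prob p {t. \<exists>x\<in>X. Q x t} \<le> real (card X) * b"
proof -
  have "{t. \<exists>x\<in>X. Q x t} = (\<Union>x\<in>X. {t. Q x t})" by auto
  then have "measure_pmf.prob p {t. \<exists>x\<in>X. Q x t} \<le> (\<Sum>x\<in>X. measure_pmf.prob p {t. Q x t})"
    using measure_pmf.finite_measure_subadditive_finite[of X "\<lambda>x. {t. Q x t}"] assms(1) by simp
  also have "\<dots> \<le> real (card X) * b" by (rule sum_bounded_above) (rule assms(2))
  finally show ?thesis .
qed

text \<open>The values at independent keys are independent and uniform. Since
  \<open>\<sigma>\<close> maps \<open>P\<close> into \<open>I - P\<close>, the equations determine
  the values on \<open>P\<close> from those outside \<open>P\<close>, so each contributes a factor
  \<open>1 / 2 ^ r\<close>.\<close>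

lemma prob_matched_keys_le:
  fixes x :: "'i \<Rightarrow> nat list"
  assumes I: "finite I" and A: "finite A" and x: "\<And>i. i \<in> I \<Longrightarrow> x i \<in> vecs n A"
    and ind: "independent_keys n x I"
    and P: "P \<subseteq> I" "\<And>i. i \<in> P \<Longrightarrow> \<sigma> i \<in> I - P"
  shows "measure_pmf.prob (random_tables n A {..<2 ^ r :: nat})
      {T. \<forall>i\<in>P. simple_tab xor 0 T (x i) = simple_tab xor 0 T (x (\<sigma> i))} \<le> 1 / (2 ^ r) ^ card P"
proof -
  let ?M = "random_tables n A {..<2 ^ r :: nat}"
  let ?f = "\<lambda>T i. if i \<in> I then simple_tab xor 0 T (x i) else (undefined :: nat)"
  let ?B = "PiE_dflt I undefined (\<lambda>_. {..<2 ^ r :: nat})"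
  have PI: "card P \<le> card I" using P I by (intro card_mono)
  have "measure_pmf.prob ?M {T. \<forall>i\<in>P. simple_tab xor 0 T (x i) = simple_tab xor 0 T (x (\<sigma> i))}
    = measure_pmf.prob (map_pmf ?f ?M) {v. \<forall>i\<in>P. v i = v (\<sigma> i)}"
    unfolding measure_map_pmf using P by (intro arg_cong[where f = "measure_pmf.prob ?M"]) (auto simp: subset_iff)
  also have "map_pmf ?f ?M = Pi_pmf I undefined (\<lambda>_. pmf_of_set {..<2 ^ r})"
    by (rule simple_tab_independent_keys_uniform[OF I A x ind])
  also have "\<dots> = pmf_of_set ?B"
    using I by (intro Pi_pmf_of_set) (auto simp: lessThan_empty_iff)
  also have "measure_pmf.prob (pmf_of_set ?B) {v. \<forall>i\<in>P. v i = v (\<sigma> i)}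
    = card (?B \<inter> {v. \<forall>i\<in>P. v i = v (\<sigma> i)}) / card ?B"
    using I by (intro measure_pmf_of_set) (auto simp: lessThan_empty_iff)
  also have "\<dots> \<le> (2 ^ r) ^ (card I - card P) / (2 ^ r) ^ card I"
  proof (rule frac_le)
    have "card (?B \<inter> {v. \<forall>i\<in>P. v i = v (\<sigma> i)}) \<le> card (PiE (I - P) (\<lambda>_. {..<2 ^ r :: nat}))"
    proof (rule card_inj_on_le[where f = "\<lambda>v. restrict v (I - P)"])
      show "inj_on (\<lambda>v. restrict v (I - P)) (?B \<inter> {v. \<forall>i\<in>P. v i = v (\<sigma> i)})"
      proof (rule inj_onI, rule ext)
        fix v w i assume v: "v \<in> ?B \<inter> {v. \<forall>i\<in>P. v i = v (\<sigma> i)}"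
          and w: "w \<in> ?B \<inter> {v. \<forall>i\<in>P. v i = v (\<sigma> i)}"
          and eq: "restrict v (I - P) = restrict w (I - P)"
        have eq': "v j = w j" if "j \<in> I - P" for j using fun_cong[OF eq, of j] that by simp
        show "v i = w i"
        proof (cases "i \<in> I")
          case True
          then show ?thesis using eq'[of i] eq'[OF P(2), of i] v w by (cases "i \<in> P") auto
        qed (use v w in \<open>simp add: PiE_dflt_def\<close>)
      qed
    next
      show "(\<lambda>v. restrict v (I - P)) ` (?B \<inter> {v. \<forall>i\<in>P. v i = v (\<sigma> i)}) \<subseteq> PiE (I - P) (\<lambda>_. {..<2 ^ r})"
      proof (rule image_subsetI)
        fix v assume v: "v \<in> ?B \<inter> {v. \<forall>i\<in>P. v i = v (\<sigma> i)}"
        show "restrict v (I - P) \<in> PiE (I - P) (\<lambda>_. {..<2 ^ r})"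
          using v by (intro PiE_I) (auto simp: PiE_dflt_def)
      qed
      show "finite (PiE (I - P) (\<lambda>_. {..<2 ^ r :: nat}))" using I by (intro finite_PiE) auto
    qed
    also have "\<dots> = (2 ^ r) ^ (card I - card P)"
      using I P by (simp add: card_PiE card_Diff_subset finite_subset)
    finally have "real (card (?B \<inter> {v. \<forall>i\<in>P. v i = v (\<sigma> i)})) \<le> real ((2 ^ r) ^ (card I - card P))"
      by (rule of_nat_mono)
    then show "real (card (?B \<inter> {v. \<forall>i\<in>P. v i = v (\<sigma> i)})) \<le> (2 ^ r) ^ (card I - card P)"
      by simp
  qed (use I in \<open>simp_all add: card_PiE_dflt\<close>)
  also have "\<dots> = 1 / (2 ^ r) ^ card P" using PI by (simp add: power_diff)
  finally show ?thesis .
qed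

definition random_table_pair ::
  "nat \<Rightarrow> nat set \<Rightarrow> nat \<Rightarrow> ((nat \<Rightarrow> nat \<Rightarrow> nat) \<times> (nat \<Rightarrow> nat \<Rightarrow> nat)) pmf" where
  "random_table_pair n A r = pair_pmf (random_tables n A {..<2 ^ r}) (random_tables n A {..<2 ^ r})"

text \<open>The two hash functions have independent tables, so the index sets charged for the first
  and for the second may overlap without losing factors.\<close>

lemma prob_matched_keys_pair_le:
  fixes x :: "nat \<Rightarrow> nat list"
  assumes I: "finite I" and A: "finite A" and x: "\<And>i. i \<in> I \<Longrightarrow> x i \<in> vecs n A"
    and ind: "independent_keys n x I"
    and P: "P \<subseteq> I" "\<And>i. i \<in> P \<Longrightarrow> \<sigma> i \<in> I - P" and P': "P' \<subseteq> I" "\<And>i. i \<in> P' \<Longrightarrow> \<tau> i \<in> I - P'"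
    and Q: "\<And>f g. Q f g \<Longrightarrow> (\<forall>i\<in>P. f (x i) = f (x (\<sigma> i))) \<and> (\<forall>i\<in>P'. g (x i) = g (x (\<tau> i)))"
    and card: "card P + card P' = l"
  shows "measure_pmf.prob (random_table_pair n A r)
      {(T, U). Q (simple_tab xor 0 T) (simple_tab xor 0 U)} \<le> 1 / (2 ^ r) ^ l"
proof -
  let ?M = "random_tables n A {..<2 ^ r :: nat}"
  let ?E = "\<lambda>P \<sigma>. {T. \<forall>i\<in>P. simple_tab xor 0 T (x i) = simple_tab xor (0 :: nat) T (x (\<sigma> i))}"
  have "measure_pmf.prob (random_table_pair n A r) {(T, U). Q (simple_tab xor 0 T) (simple_tab xor 0 U)}
    \<le> measure_pmf.prob (random_table_pair n A r) (?E P \<sigma> \<times> ?E P' \<tau>)"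
    by (rule measure_pmf.finite_measure_mono) (use Q in auto)
  also have "\<dots> = measure_pmf.prob ?M (?E P \<sigma>) * measure_pmf.prob ?M (?E P' \<tau>)"
    unfolding random_table_pair_def by (rule measure_pmf_prob_Times)
  also have "\<dots> \<le> (1 / (2 ^ r) ^ card P) * (1 / (2 ^ r) ^ card P')"
    by (intro mult_mono prob_matched_keys_le[OF I A x ind] P P') auto
  also have "\<dots> = 1 / (2 ^ r) ^ l" by (simp flip: card add: power_add)
  finally show ?thesis .
qed

lemma card_even_odd: "card {i. i < q \<and> even i} + card {i. i < q \<and> odd i} = (q :: nat)"
proof -
  have "card ({i. i < q \<and> even i} \<union> {i. i < q \<and> odd i}) = card {i. i < q \<and> even i} + card {i. i < q \<and> odd i}"
    by (intro card_Un_disjoint) auto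
  moreover have "{i. i < q \<and> even i} \<union> {i. i < q \<and> odd i} = {..<q}" by auto
  ultimately show ?thesis by simp
qed

lemma prob_alternating_walk_le:
  fixes x :: "nat \<Rightarrow> nat list"
  assumes A: "finite A" and x: "\<And>i. i \<le> q \<Longrightarrow> x i \<in> vecs n A"
    and ind: "independent_keys n x {..q}"
  shows "measure_pmf.prob (random_table_pair n A r)
      {(T, U). alternating_walk (simple_tab xor 0 T) (simple_tab xor 0 U) x q} \<le> 1 / (2 ^ r) ^ q"
\<comment> \<open>The equation of step \<open>i\<close> is charged to the index
  \<open>Suc i\<close>. Steps of one parity form a matching, so the other end \<open>i\<close> is
  not charged for the same function.\<close>
proof (rule prob_matched_keys_pair_le[OF _ A _ ind, where P = "Suc ` {i. i < q \<and> even i}"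
      and P' = "Suc ` {i. i < q \<and> odd i}" and \<sigma> = "\<lambda>i. i - 1" and \<tau> = "\<lambda>i. i - 1"])
  show "card (Suc ` {i. i < q \<and> even i}) + card (Suc ` {i. i < q \<and> odd i}) = q"
    using card_even_odd by (simp add: card_image)
qed (use x in \<open>auto simp: alternating_walk_def\<close>)

text \<open>A cycle on \<open>q\<close> keys carries \<open>q\<close> equations although only
  \<open>q - 1\<close> of its keys can be chosen freely once the start is fixed; this surplus is the
  extra factor. The closing equation is charged to index 0, and its other end \<open>q - 1\<close>
  is odd because \<open>q\<close> is even.\<close>

lemma prob_alternating_cycle_le:
  fixes x :: "nat \<Rightarrow> nat list"
  assumes A: "finite A" and x: "\<And>i. i < q \<Longrightarrow> x i \<in> vecs n A"
    and ind: "independent_keys n x {..<q}" and q: "even q" "q \<ge> 1"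
  shows "measure_pmf.prob (random_table_pair n A r)
      {(T, U). alternating_walk (simple_tab xor 0 T) (simple_tab xor 0 U) x (q - 1) \<and>
         simple_tab xor 0 U (x (q - 1)) = simple_tab xor 0 U (x 0)} \<le> 1 / (2 ^ r) ^ q"
proof (rule prob_matched_keys_pair_le[OF _ A _ ind, where P = "{i. i < q \<and> odd i}"
      and P' = "{i. i < q \<and> even i}" and \<sigma> = "\<lambda>i. i - 1" and \<tau> = "\<lambda>i. if i = 0 then q - 1 else i - 1"
      and Q = "\<lambda>f g. alternating_walk f g x (q - 1) \<and> g (x (q - 1)) = g (x 0)"])
  show "card {i. i < q \<and> odd i} + card {i. i < q \<and> even i} = q"
    using card_even_odd[of q] by simp
next
  fix f g :: "nat list \<Rightarrow> nat"
  assume *: "alternating_walk f g x (q - 1) \<and> g (x (q - 1)) = g (x 0)"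
  have "f (x i) = f (x (i - 1))" if "i < q" "odd i" for i
    using that * by (cases i) (auto simp: alternating_walk_def)
  moreover have "g (x i) = g (x (if i = 0 then q - 1 else i - 1))" if "i < q" "even i" for i
    using that * by (cases i) (auto simp: alternating_walk_def)
  ultimately show "(\<forall>i\<in>{i. i < q \<and> odd i}. f (x i) = f (x (i - 1))) \<and>
      (\<forall>i\<in>{i. i < q \<and> even i}. g (x i) = g (x (if i = 0 then q - 1 else i - 1)))" by blast
qed (use x q in \<open>auto split: if_splits\<close>)

lemma prob_matched_pairs_coordinates:
  fixes M :: "'a pmf"
  assumes "2 * D \<le> d"
  shows "measure_pmf.prob (Pi_pmf {..<d} dflt (\<lambda>_. M)) {F. \<forall>p<D. Q (F (2 * p)) (F (2 * p + 1))}
    = measure_pmf.prob (pair_pmf M M) {(a, b). Q a b} ^ D"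
proof -
  let ?E = "\<lambda>D. {F. \<forall>p<D. Q (F (2 * p)) (F (2 * p + 1))}"
  let ?P = "\<lambda>n. Pi_pmf {..<n} dflt (\<lambda>_. M)"
  have *: "measure_pmf.prob (?P (2 * D)) (?E D) = measure_pmf.prob (pair_pmf M M) {(a, b). Q a b} ^ D" for D
  proof (induction D)
    case (Suc D)
    let ?u = "\<lambda>((a, b), F). F(2 * D := a, 2 * D + 1 := b)"
    have "{..<2 * Suc D} = insert (2 * D + 1) (insert (2 * D) {..<2 * D})" by auto
    then have "?P (2 * Suc D) = do {b \<leftarrow> M; a \<leftarrow> M; F \<leftarrow> ?P (2 * D); return_pmf (F(2 * D := a, 2 * D + 1 := b))}"
      by (simp add: Pi_pmf_insert' bind_assoc_pmf bind_return_pmf)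
    also have "\<dots> = do {a \<leftarrow> M; b \<leftarrow> M; F \<leftarrow> ?P (2 * D); return_pmf (F(2 * D := a, 2 * D + 1 := b))}"
      by (rule bind_commute_pmf)
    also have "\<dots> = map_pmf ?u (pair_pmf (pair_pmf M M) (?P (2 * D)))"
      by (simp add: pair_pmf_def map_pmf_def bind_assoc_pmf bind_return_pmf)
    finally have P: "?P (2 * Suc D) = map_pmf ?u (pair_pmf (pair_pmf M M) (?P (2 * D)))" .
    have "?u -` ?E (Suc D) = {(a, b). Q a b} \<times> ?E D"
    proof (rule set_eqI)
      fix z :: "('a \<times> 'a) \<times> (nat \<Rightarrow> 'a)"
      obtain a b F where z: "z = ((a, b), F)" by (cases z) auto
      have "?u z (2 * p) = F (2 * p)" "?u z (2 * p + 1) = F (2 * p + 1)" if "p < D" for p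
        using that by (auto simp: z)
      then show "z \<in> ?u -` ?E (Suc D) \<longleftrightarrow> z \<in> {(a, b). Q a b} \<times> ?E D"
        by (auto simp: z less_Suc_eq)
    qed
    then show ?case using Suc by (simp only: P measure_map_pmf measure_pmf_prob_Times power_Suc)
  qed simp
  \<comment> \<open>The coordinates from \<open>2 * D\<close> on do not occur in the event and are
    projected away; for odd \<open>d\<close> and \<open>D = d div 2\<close> this is the last
    one.\<close>
  have "?P (2 * D) = map_pmf (\<lambda>F i. if i \<in> {..<2 * D} then F i else dflt) (?P d)"
    using assms by (intro Pi_pmf_subset) auto
  then have "measure_pmf.prob (?P (2 * D)) (?E D)
    = measure_pmf.prob (?P d) ((\<lambda>F i. if i \<in> {..<2 * D} then F i else dflt) -` ?E D)"
    by (simp only: measure_map_pmf)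
  also have "(\<lambda>F i. if i \<in> {..<2 * D} then F i else dflt) -` ?E D = ?E D" by auto
  finally show ?thesis using * by simp
qed

lemma foldr_xor_vec:
  assumes "\<And>i. i \<in> set ps \<Longrightarrow> length (g i) = d"
  shows "length (foldr (\<lambda>i. xor_vec (g i)) ps (replicate d 0)) = d \<and>
    (\<forall>j<d. foldr (\<lambda>i. xor_vec (g i)) ps (replicate d 0) ! j = foldr (\<lambda>i. xor (g i ! j)) ps 0)"
  using assms
proof (induction ps)
  case (Cons i ps)
  then have "length (g i) = d" by simp
  with Cons show ?case by (simp add: xor_vec_def)
qed simp

lemma simple_tab_xor_vec:
  assumes "\<And>i. i < length x \<Longrightarrow> length (T i (x ! i)) = d"
  shows "length (simple_tab xor_vec (replicate d 0) T x) = d"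
    and "j < d \<Longrightarrow> simple_tab xor_vec (replicate d 0) T x ! j = simple_tab xor 0 (\<lambda>i a. T i a ! j) x"
  using foldr_xor_vec[of "[0..<length x]" "\<lambda>i. T i (x ! i)" d] assms by (simp_all add: simple_tab_def)

text \<open>Transposes a table of vectors into a vector of tables. The \<open>undefined\<close>
  values agree with the defaults of the nested \<open>Pi_pmf\<close>, so that the image law is
  exactly a product and not only up to irrelevant entries.\<close>

definition table_coordinates :: "nat \<Rightarrow> nat \<Rightarrow> nat set \<Rightarrow> (nat \<Rightarrow> nat \<Rightarrow> 'b list) \<Rightarrow> nat \<Rightarrow> nat \<Rightarrow> nat \<Rightarrow> 'b" where
  "table_coordinates d n A T = (\<lambda>j. if j < d
     then (\<lambda>i. if i < n then (\<lambda>a. if a \<in> A then T i a ! j else undefined) else undefined)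
     else undefined)"

text \<open>Both sides are uniform on finite sets, and transposition is a bijection between these
  sets with inverse \<open>?\<Phi>\<close>.\<close>

lemma map_pmf_table_coordinates:
  assumes A: "finite A" and B: "finite B" "B \<noteq> {}"
  shows "map_pmf (table_coordinates d n A) (random_tables n A (vecs d B))
    = Pi_pmf {..<d} undefined (\<lambda>_. random_tables n A B)"
proof -
  let ?\<Phi> = "\<lambda>F :: nat \<Rightarrow> nat \<Rightarrow> nat \<Rightarrow> 'a. \<lambda>i. if i < n then
     (\<lambda>a. if a \<in> A then map (\<lambda>j. F j i a) [0..<d] else undefined) else undefined"
  let ?W = "\<lambda>R. PiE_dflt {..<n} undefined (\<lambda>_. PiE_dflt A undefined (\<lambda>_. R))"
  have ne: "vecs d B \<noteq> {}"
  proof -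
    obtain b where "b \<in> B" using B by blast
    then have "replicate d b \<in> vecs d B" by (auto simp: vecs_def)
    then show ?thesis by blast
  qed
  have "bij_betw (table_coordinates d n A) (?W (vecs d B)) (PiE_dflt {..<d} undefined (\<lambda>_. ?W B))"
  proof (rule bij_betw_byWitness[where f' = ?\<Phi>])
    show "\<forall>T\<in>?W (vecs d B). ?\<Phi> (table_coordinates d n A T) = T"
    proof
      fix T assume T: "T \<in> ?W (vecs d B)"
      have "?\<Phi> (table_coordinates d n A T) i a = T i a" for i a
      proof (cases "i < n \<and> a \<in> A")
        case True
        then have "length (T i a) = d" using T by (auto simp: PiE_dflt_def vecs_def)
        then show ?thesis using True
          by (auto simp: table_coordinates_def intro!: nth_equalityI)
      next
        case False
        then show ?thesis using T by (auto simp: PiE_dflt_def)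
      qed
      then show "?\<Phi> (table_coordinates d n A T) = T" by blast
    qed
    show "\<forall>F\<in>PiE_dflt {..<d} undefined (\<lambda>_. ?W B). table_coordinates d n A (?\<Phi> F) = F"
    proof
      fix F assume F: "F \<in> PiE_dflt {..<d} undefined (\<lambda>_. ?W B)"
      have "table_coordinates d n A (?\<Phi> F) j i a = F j i a" for j i a
        using F by (auto simp: table_coordinates_def PiE_dflt_def)
      then show "table_coordinates d n A (?\<Phi> F) = F" by blast
    qed
    show "table_coordinates d n A ` ?W (vecs d B) \<subseteq> PiE_dflt {..<d} undefined (\<lambda>_. ?W B)"
    proof (rule image_subsetI)
      fix T assume T: "T \<in> ?W (vecs d B)"
      have "T i a ! j \<in> B" if "i < n" "a \<in> A" "j < d" for i a j
      proof -
        have "T i a \<in> vecs d B" using T that by (simp add: PiE_dflt_def)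
        then have "length (T i a) = d" "set (T i a) \<subseteq> B" by (simp_all add: vecs_def)
        then show ?thesis using \<open>j < d\<close> by (meson nth_mem subsetD)
      qed
      then show "table_coordinates d n A T \<in> PiE_dflt {..<d} undefined (\<lambda>_. ?W B)"
        by (simp add: PiE_dflt_def table_coordinates_def)
    qed
    show "?\<Phi> ` PiE_dflt {..<d} undefined (\<lambda>_. ?W B) \<subseteq> ?W (vecs d B)"
      by (auto simp: PiE_dflt_def vecs_def)
  qed
  then have "map_pmf (table_coordinates d n A) (pmf_of_set (?W (vecs d B)))
    = pmf_of_set (PiE_dflt {..<d} undefined (\<lambda>_. ?W B))"
    using A B ne by (intro map_pmf_of_set_bij_betw) auto
  also have "\<dots> = Pi_pmf {..<d} undefined (\<lambda>_. pmf_of_set (?W B))"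
    using A B by (intro Pi_pmf_of_set[symmetric]) auto
  finally show ?thesis
    using random_tables_eq_pmf_of_set[OF A B] random_tables_eq_pmf_of_set[OF A _ ne] B by simp
qed

section \<open>Union bound over the alternating walks from a fixed key\<close>

definition prob_pair :: "nat \<Rightarrow> nat set \<Rightarrow> nat \<Rightarrow> ((nat list \<Rightarrow> nat) \<Rightarrow> (nat list \<Rightarrow> nat) \<Rightarrow> bool) \<Rightarrow> real" where
  "prob_pair n A r Q = measure_pmf.prob (random_table_pair n A r)
     {(T, U). Q (simple_tab xor 0 T) (simple_tab xor 0 U)}"

lemma prob_pair_le_1: "prob_pair n A r Q \<le> 1"
  by (simp add: prob_pair_def)

lemma prob_pair_mono: "(\<And>f g. Q f g \<Longrightarrow> Q' f g) \<Longrightarrow> prob_pair n A r Q \<le> prob_pair n A r Q'"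
  unfolding prob_pair_def by (rule measure_pmf.finite_measure_mono) auto

lemma prob_pair_disj_le:
  "prob_pair n A r (\<lambda>f g. Q f g \<or> Q' f g) \<le> prob_pair n A r Q + prob_pair n A r Q'"
proof -
  have "{(T, U). Q (simple_tab xor 0 T) (simple_tab xor 0 U) \<or> Q' (simple_tab xor 0 T) (simple_tab xor 0 U)}
    = {(T, U). Q (simple_tab xor 0 T) (simple_tab xor 0 U)} \<union> {(T, U). Q' (simple_tab xor 0 T) (simple_tab xor 0 U)}"
    by auto
  then show ?thesis
    unfolding prob_pair_def by (simp add: measure_Un_le)
qed

lemma prob_pair_bex_le_sum:
  assumes "finite X"
  shows "prob_pair n A r (\<lambda>f g. \<exists>x\<in>X. Q x f g) \<le> (\<Sum>x\<in>X. prob_pair n A r (Q x))"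
  using assms
proof induction
  case empty
  then show ?case by (simp add: prob_pair_def)
next
  case (insert x X)
  have "prob_pair n A r (\<lambda>f g. \<exists>y\<in>insert x X. Q y f g)
    \<le> prob_pair n A r (\<lambda>f g. Q x f g \<or> (\<exists>y\<in>X. Q y f g))"
    by (rule prob_pair_mono) auto
  also have "\<dots> \<le> prob_pair n A r (Q x) + prob_pair n A r (\<lambda>f g. \<exists>y\<in>X. Q y f g)"
    by (rule prob_pair_disj_le)
  finally show ?case using insert by simp
qed

lemma prob_pair_bex_le:
  assumes "finite X" "\<And>x. x \<in> X \<Longrightarrow> prob_pair n A r (Q x) \<le> b"
  shows "prob_pair n A r (\<lambda>f g. \<exists>x\<in>X. Q x f g) \<le> real (card X) * b"
  using prob_pair_bex_le_sum[OF assms(1), of n A r Q] sum_bounded_above[of X "\<lambda>x. prob_pair n A r (Q x)" b] assms(2)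
  by simp

lemma prob_pair_conj_const:
  assumes "P \<Longrightarrow> prob_pair n A r Q \<le> b" "0 \<le> b"
  shows "prob_pair n A r (\<lambda>f g. P \<and> Q f g) \<le> b"
  using assms by (cases P) (simp_all add: prob_pair_def)

lemma independent_keys_cong:
  "(\<And>i. i \<in> I \<Longrightarrow> x i = y i) \<Longrightarrow> independent_keys n x I = independent_keys n y I"
proof -
  assume "\<And>i. i \<in> I \<Longrightarrow> x i = y i"
  then have "zero_sum n x J = zero_sum n y J" if "J \<subseteq> I" for J
    using that by (intro zero_sum_cong) auto
  then show ?thesis by (auto simp: independent_keys_def)
qed

lemma alternating_walk_cong:
  assumes "\<And>i. i \<le> q \<Longrightarrow> x i = y i"
  shows "alternating_walk f g x q = alternating_walk f g y q"
  using assms by (simp add: alternating_walk_def)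

text \<open>The costs of a walk that stays independent for \<open>N\<close> steps, of one closing
  into a cycle of length \<open>q\<close>, and of one that becomes dependent at index
  \<open>q\<close>, for an alphabet of size \<open>m\<close> and \<open>w\<close> keys. In the last
  sum \<open>real (q + 1) ^ (2 * t)\<close> bounds the choices of the zero-sum positions, and only
  \<open>q - 1\<close> equations count because index \<open>q\<close> is no longer independent.
  \<open>t\<close> starts at 2, since a pair is a repeated key and belongs to the cycles.\<close>

definition walk_bound :: "nat \<Rightarrow> nat \<Rightarrow> real \<Rightarrow> real \<Rightarrow> real" where
  "walk_bound n N m w = w ^ N / m ^ N + (\<Sum>q\<in>{1..N}. w ^ (q - 1) / m ^ q) +
     (\<Sum>q\<in>{1..N}. \<Sum>t\<in>{2..(q + 1) div 2}.
        real (q + 1) ^ (2 * t) * (tuple_factor n t * w ^ (q - t)) / m ^ (q - 1))"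

lemma prob_even_fibers_le:
  assumes A: "finite A" and W: "W \<subseteq> vecs n A" "x0 \<in> W" and n: "n \<ge> 1" and good: "good_key n N x0 W"
  shows "prob_pair n A r (\<lambda>f g. \<exists>Y\<subseteq>W. x0 \<in> Y \<and> even_fibers f Y \<and> even_fibers g Y)
    \<le> walk_bound n N (2 ^ r) (real (card W))"
proof -
  let ?w = "real (card W)" and ?m = "(2 :: real) ^ r"
  let ?U = "\<lambda>i :: nat. if i = 0 then {x0} else W"
  let ?closed = "\<lambda>q x f g. alternating_walk f g x (q - 1) \<and> g (x (q - 1)) = g (x 0)"
  let ?Qb = "\<lambda>f g. \<exists>x\<in>PiE {..N} ?U. independent_keys n x {..N} \<and> alternating_walk f g x N"
  let ?Qa = "\<lambda>q f g. \<exists>x\<in>PiE {..<q} ?U. (even q \<and> independent_keys n x {..<q}) \<and> ?closed q x f g"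
  let ?Qc = "\<lambda>q t f g. \<exists>J\<in>{J. J \<subseteq> {..q} \<and> card J = 2 * t}. \<exists>x\<in>{x \<in> PiE {..q} ?U. zero_sum n x J}.
      independent_keys n x {..<q} \<and> alternating_walk f g x (q - 1)"
  have fW: "finite W" using W(1) by (rule finite_subset) (simp add: A)
  have fPi: "finite (PiE {..q} ?U)" "finite (PiE {..<q} ?U)" for q using fW by (auto intro!: finite_PiE)
  have UW: "?U i \<subseteq> vecs n A" for i using W by auto
  \<comment> \<open>The walk is cut to an extensional function on its relevant indices, so that the
    union bound ranges over finite sets. Independence is part of each event because it does not
    depend on \<open>f\<close> and \<open>g\<close>: dependent tuples contribute probability
    0.\<close>
  have cover: "?Qb f g \<or> (\<exists>q\<in>{1..N}. ?Qa q f g) \<or> (\<exists>q\<in>{1..N}. \<exists>t\<in>{2..(q + 1) div 2}. ?Qc q t f g)"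
    if ex: "\<exists>Y\<subseteq>W. x0 \<in> Y \<and> even_fibers f Y \<and> even_fibers g Y" for f g
  proof -
    obtain Y where Y: "Y \<subseteq> W" "x0 \<in> Y" "even_fibers f Y" "even_fibers g Y" using ex by blast
    have fY: "finite Y" "Y \<subseteq> vecs n A" using Y(1) fW W finite_subset by blast+
    obtain x where x: "x 0 = x0" "\<And>i. x i \<in> Y" "\<And>q. alternating_walk f g x q"
      "independent_keys n x {..N} \<or> (\<exists>q\<in>{1..N}. independent_keys n x {..<q} \<and>
       ((even q \<and> g (x (q - 1)) = g (x 0)) \<or>
        (\<exists>J\<subseteq>{..q}. zero_sum n x J \<and> even (card J) \<and> card J \<ge> 4)))"
      using alternating_walk_cases[OF fY(1) Y(3,4,2) fY(2) n, of N] by blast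
    have xU: "x i \<in> ?U i" for i using x(1,2) Y(1) by auto
    from x(4) consider (b) "independent_keys n x {..N}"
      | (a) q where "q \<in> {1..N}" "independent_keys n x {..<q}" "even q" "g (x (q - 1)) = g (x 0)"
      | (c) q J where "q \<in> {1..N}" "independent_keys n x {..<q}" "J \<subseteq> {..q}" "zero_sum n x J"
          "even (card J)" "card J \<ge> 4" by blast
    then show ?thesis
    proof cases
      case b
      let ?x = "restrict x {..N}"
      have "?x \<in> PiE {..N} ?U" using xU by auto
      moreover have "independent_keys n ?x {..N}" using b by (subst independent_keys_cong[of _ _ x]) auto
      moreover have "alternating_walk f g ?x N" using x(3)[of N] by (subst alternating_walk_cong[of _ _ x]) auto
      ultimately show ?thesis by blast
    next
      case a
      let ?x = "restrict x {..<q}"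
      have "?x \<in> PiE {..<q} ?U" using xU by auto
      moreover have "independent_keys n ?x {..<q}" using a(2) by (subst independent_keys_cong[of _ _ x]) auto
      moreover have "alternating_walk f g ?x (q - 1)"
        using x(3)[of "q - 1"] a(1) by (subst alternating_walk_cong[of _ _ x]) auto
      moreover have "g (?x (q - 1)) = g (?x 0)" using a by simp
      ultimately have "?Qa q f g" using a(3) by blast
      then show ?thesis using a(1) by blast
    next
      case c
      let ?x = "restrict x {..q}"
      have "card J \<le> q + 1" using card_mono[OF _ c(3)] by simp
      then obtain t where t: "card J = 2 * t" "t \<in> {2..(q + 1) div 2}" using c(5,6) by (auto elim!: evenE)
      have "?x \<in> PiE {..q} ?U" using xU by auto
      moreover have "zero_sum n ?x J" using c(3,4) by (subst zero_sum_cong[of _ _ x]) auto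
      moreover have "independent_keys n ?x {..<q}"
        using c(2) by (subst independent_keys_cong[of _ _ x]) auto
      moreover have "alternating_walk f g ?x (q - 1)"
        using x(3)[of "q - 1"] by (subst alternating_walk_cong[of _ _ x]) auto
      ultimately have "?Qc q t f g" using c(3) t(1) by blast
      then show ?thesis using c(1) t(2) by blast
    qed
  qed
  have b: "prob_pair n A r ?Qb \<le> ?w ^ N / ?m ^ N"
  proof -
    have "prob_pair n A r ?Qb \<le> real (card (PiE {..N} ?U)) * (1 / ?m ^ N)"
    proof (rule prob_pair_bex_le[OF fPi(1)], rule prob_pair_conj_const)
      fix x assume x: "x \<in> PiE {..N} ?U" and ind: "independent_keys n x {..N}"
      have "x i \<in> vecs n A" if "i \<le> N" for i using PiE_mem[OF x, of i] UW[of i] that by auto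
      then show "prob_pair n A r (\<lambda>f g. alternating_walk f g x N) \<le> 1 / ?m ^ N"
        unfolding prob_pair_def by (rule prob_alternating_walk_le[OF A _ ind])
    qed simp
    also have "card (PiE {..N} ?U) = card W ^ N"
    proof -
      have "(\<Prod>i\<in>{..N}. card (?U i)) = (\<Prod>i\<in>{..N} - {0}. card (?U i))"
        by (subst prod.remove[of _ 0]) auto
      also have "\<dots> = (\<Prod>i\<in>{..N} - {0}. card W)" by (rule prod.cong) auto
      finally show ?thesis by (simp add: card_PiE)
    qed
    finally show ?thesis by simp
  qed
  have a: "prob_pair n A r (?Qa q) \<le> ?w ^ (q - 1) / ?m ^ q" if q: "q \<in> {1..N}" for q
  proof -
    have "prob_pair n A r (?Qa q) \<le> real (card (PiE {..<q} ?U)) * (1 / ?m ^ q)"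
    proof (rule prob_pair_bex_le[OF fPi(2)], rule prob_pair_conj_const)
      fix x assume x: "x \<in> PiE {..<q} ?U" and ind: "even q \<and> independent_keys n x {..<q}"
      have "x i \<in> vecs n A" if "i < q" for i using PiE_mem[OF x, of i] UW[of i] that by auto
      then show "prob_pair n A r (?closed q x) \<le> 1 / ?m ^ q"
        unfolding prob_pair_def using ind q by (intro prob_alternating_cycle_le[OF A]) auto
    qed simp
    also have "card (PiE {..<q} ?U) = card W ^ (q - 1)"
    proof -
      have "(\<Prod>i\<in>{..<q}. card (?U i)) = (\<Prod>i\<in>{..<q} - {0}. card (?U i))"
        using q by (subst prod.remove[of _ 0]) auto
      also have "\<dots> = (\<Prod>i\<in>{..<q} - {0}. card W)" by (rule prod.cong) auto
      also have "\<dots> = card W ^ (q - 1)" using q by (simp add: card_Diff_singleton_if)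
      finally show ?thesis by (simp add: card_PiE)
    qed
    finally show ?thesis by simp
  qed
  have c: "prob_pair n A r (?Qc q t)
      \<le> real (q + 1) ^ (2 * t) * (tuple_factor n t * ?w ^ (q - t)) / ?m ^ (q - 1)"
    if q: "q \<in> {1..N}" and t: "t \<in> {2..(q + 1) div 2}" for q t
  proof -
    let ?Js = "{J. J \<subseteq> {..q} \<and> card J = 2 * t}"
    have tN: "t \<in> {1..N}" using q t by auto
    have "prob_pair n A r (?Qc q t) \<le> real (card ?Js) * (tuple_factor n t * ?w ^ (q - t) * (1 / ?m ^ (q - 1)))"
    proof (rule prob_pair_bex_le)
      fix J assume J: "J \<in> ?Js"
      let ?X = "{x \<in> PiE {..q} ?U. zero_sum n x J}"
      have "prob_pair n A r (\<lambda>f g. \<exists>x\<in>?X. independent_keys n x {..<q} \<and> alternating_walk f g x (q - 1))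
        \<le> real (card ?X) * (1 / ?m ^ (q - 1))"
      proof (rule prob_pair_bex_le, rule finite_subset[OF _ fPi(1)[of q]], blast, rule prob_pair_conj_const)
        fix x assume x: "x \<in> ?X" and ind: "independent_keys n x {..<q}"
        have "{..<q} = {..q - 1}" using q by auto
        then have ind': "independent_keys n x {..q - 1}" using ind by simp
        have "x i \<in> vecs n A" if "i \<le> q - 1" for i
          using PiE_mem[of x "{..q}" ?U i] x UW[of i] that by auto
        then show "prob_pair n A r (\<lambda>f g. alternating_walk f g x (q - 1)) \<le> 1 / ?m ^ (q - 1)"
          unfolding prob_pair_def by (rule prob_alternating_walk_le[OF A _ ind'])
      qed simp
      also have "\<dots> \<le> tuple_factor n t * ?w ^ (q - t) * (1 / ?m ^ (q - 1))"
        using J tN by (intro mult_right_mono card_pinned_zero_sum_tuples_le[OF good A W]) auto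
      finally show "prob_pair n A r (\<lambda>f g. \<exists>x\<in>?X. independent_keys n x {..<q} \<and> alternating_walk f g x (q - 1))
        \<le> tuple_factor n t * ?w ^ (q - t) * (1 / ?m ^ (q - 1))" .
    qed simp
    also have "\<dots> \<le> real (q + 1) ^ (2 * t) * (tuple_factor n t * ?w ^ (q - t) * (1 / ?m ^ (q - 1)))"
    proof (rule mult_right_mono)
      have "card ?Js = (q + 1) choose (2 * t)" using n_subsets[of "{..q}" "2 * t"] by simp
      also have "\<dots> \<le> (q + 1) ^ (2 * t)" using t by (intro binomial_le_pow) auto
      finally have "real (card ?Js) \<le> real ((q + 1) ^ (2 * t))" by (rule of_nat_mono)
      then show "real (card ?Js) \<le> real (q + 1) ^ (2 * t)" by simp
      show "0 \<le> tuple_factor n t * ?w ^ (q - t) * (1 / ?m ^ (q - 1))" by (simp add: tuple_factor_def)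
    qed
    finally show ?thesis by simp
  qed
  have "prob_pair n A r (\<lambda>f g. \<exists>Y\<subseteq>W. x0 \<in> Y \<and> even_fibers f Y \<and> even_fibers g Y)
    \<le> prob_pair n A r (\<lambda>f g. ?Qb f g \<or> ((\<exists>q\<in>{1..N}. ?Qa q f g) \<or> (\<exists>q\<in>{1..N}. \<exists>t\<in>{2..(q + 1) div 2}. ?Qc q t f g)))"
    by (rule prob_pair_mono) (rule cover)
  also have "\<dots> \<le> prob_pair n A r ?Qb + prob_pair n A r (\<lambda>f g. (\<exists>q\<in>{1..N}. ?Qa q f g) \<or> (\<exists>q\<in>{1..N}. \<exists>t\<in>{2..(q + 1) div 2}. ?Qc q t f g))"
    by (rule prob_pair_disj_le)
  also have "\<dots> \<le> prob_pair n A r ?Qb + (prob_pair n A r (\<lambda>f g. \<exists>q\<in>{1..N}. ?Qa q f g) + prob_pair n A r (\<lambda>f g. \<exists>q\<in>{1..N}. \<exists>t\<in>{2..(q + 1) div 2}. ?Qc q t f g))"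
    by (intro add_left_mono prob_pair_disj_le)
  also have "\<dots> \<le> ?w ^ N / ?m ^ N + ((\<Sum>q\<in>{1..N}. ?w ^ (q - 1) / ?m ^ q) +
     (\<Sum>q\<in>{1..N}. \<Sum>t\<in>{2..(q + 1) div 2}.
        real (q + 1) ^ (2 * t) * (tuple_factor n t * ?w ^ (q - t)) / ?m ^ (q - 1)))"
  proof (intro add_mono b)
    show "prob_pair n A r (\<lambda>f g. \<exists>q\<in>{1..N}. ?Qa q f g) \<le> (\<Sum>q\<in>{1..N}. ?w ^ (q - 1) / ?m ^ q)"
      by (rule order_trans[OF prob_pair_bex_le_sum sum_mono]) (simp, rule a)
    show "prob_pair n A r (\<lambda>f g. \<exists>q\<in>{1..N}. \<exists>t\<in>{2..(q + 1) div 2}. ?Qc q t f g)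
      \<le> (\<Sum>q\<in>{1..N}. \<Sum>t\<in>{2..(q + 1) div 2}.
        real (q + 1) ^ (2 * t) * (tuple_factor n t * ?w ^ (q - t)) / ?m ^ (q - 1))"
      by (rule order_trans[OF prob_pair_bex_le_sum sum_mono], simp,
          rule order_trans[OF prob_pair_bex_le_sum sum_mono], simp, rule c)
  qed
  finally show ?thesis by (simp add: walk_bound_def add.assoc)
qed

subsection \<open>Summation of the union bound\<close>

lemma power_mult_geometric_tendsto_0:
  fixes x :: real
  assumes "0 < x" "x < 1"
  shows "(\<lambda>q. real q ^ j * x ^ q) \<longlonglongrightarrow> 0"
proof -
  define c where "c = - ln x"
  have c: "c > 0" using assms by (simp add: c_def)
  have ex: "exp (c * real q) = 1 / x ^ q" for q
  proof -
    have "exp (c * real q) = exp c ^ q" by (metis exp_of_nat_mult mult.commute)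
    also have "exp c = 1 / x" using assms by (simp add: c_def exp_minus inverse_eq_divide)
    finally show ?thesis by (simp add: power_divide)
  qed
  have "filterlim (\<lambda>q. c * real q) at_top sequentially"
    using c by (intro filterlim_tendsto_pos_mult_at_top[OF tendsto_const] filterlim_real_sequentially)
  then have "(\<lambda>q. (c * real q) ^ j / exp (c * real q)) \<longlonglongrightarrow> 0"
    by (rule filterlim_compose[OF tendsto_power_div_exp_0])
  then have "(\<lambda>q. (1 / c ^ j) * ((c * real q) ^ j / exp (c * real q))) \<longlonglongrightarrow> (1 / c ^ j) * 0"
    by (intro tendsto_mult tendsto_const)
  moreover have "(1 / c ^ j) * ((c * real q) ^ j / exp (c * real q)) = real q ^ j * x ^ q" for q
    using c by (simp add: ex power_mult_distrib)
  ultimately show ?thesis by simp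
qed

text \<open>With \<open>x = y * y\<close>, one power of \<open>y\<close> absorbs the polynomial and
  the other gives a geometric series.\<close>

lemma summable_power_mult_geometric:
  fixes x :: real
  assumes "0 < x" "x < 1"
  shows "summable (\<lambda>q. real q ^ j * x ^ q)"
proof -
  define y where "y = sqrt x"
  have y: "0 < y" "y < 1" "x = y * y" using assms by (simp_all add: y_def)
  have "Bseq (\<lambda>q. real q ^ j * y ^ q)"
    using power_mult_geometric_tendsto_0[OF y(1,2)] by (rule convergent_imp_Bseq[OF convergentI])
  then obtain C where C: "\<And>q. norm (real q ^ j * y ^ q) \<le> C" by (auto simp: Bseq_def)
  show ?thesis
  proof (rule summable_comparison_test')
    show "summable (\<lambda>q. C * y ^ q)" using y by (intro summable_mult summable_geometric) simp
    fix q :: nat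
    have "norm (real q ^ j * x ^ q) = norm (real q ^ j * y ^ q) * y ^ q"
      using y by (simp add: power_mult_distrib)
    also have "\<dots> \<le> C * y ^ q" using C[of q] y by (intro mult_right_mono) auto
    finally show "norm (real q ^ j * x ^ q) \<le> C * y ^ q" .
  qed
qed

text \<open>Since \<open>2 * t\<close> is at most \<open>q + 1\<close>, the choice of positions and
  the tuple count merge into the \<open>t\<close>-th power of one polynomial in \<open>q\<close>.
  The sum over \<open>t\<close> can then be compared with a geometric series.\<close>

lemma tuple_term_le:
  assumes t: "2 \<le> t" "2 * t \<le> q + 1"
  shows "real (q + 1) ^ (2 * t) * tuple_factor n t \<le> (4 * real (q + 1) ^ (2 * n + 2)) ^ t"
proof -
  have "(real (2 * t) ^ (2 * t)) ^ n \<le> (real (q + 1) ^ (2 * t)) ^ n"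
    using t by (intro power_mono) auto
  then have "real (q + 1) ^ (2 * t) * tuple_factor n t
    \<le> real (q + 1) ^ (2 * t) * (4 ^ t * (real (q + 1) ^ (2 * t)) ^ n)"
    unfolding tuple_factor_def by (intro mult_left_mono) auto
  also have "\<dots> = 4 ^ t * real (q + 1) ^ (2 * t + 2 * t * n)"
    by (simp only: power_add power_mult[symmetric] mult_ac)
  also have "2 * t + 2 * t * n = (2 * n + 2) * t" by (simp add: algebra_simps)
  also have "4 ^ t * real (q + 1) ^ ((2 * n + 2) * t) = (4 * real (q + 1) ^ (2 * n + 2)) ^ t"
    by (simp only: power_mult power_mult_distrib)
  finally show ?thesis .
qed

lemma sum_half_powers_le: "(\<Sum>t\<in>{2..M}. (1 / 2 :: real) ^ (t - 2)) \<le> 2"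
proof -
  have "(\<Sum>t\<in>{2..M}. (1 / 2 :: real) ^ (t - 2)) = (\<Sum>i\<in>(\<lambda>t. t - 2) ` {2..M}. (1 / 2) ^ i)"
    by (subst sum.reindex) (auto simp: inj_on_def)
  also have "\<dots> \<le> (\<Sum>i. (1 / 2) ^ i)"
    by (intro sum_le_suminf summable_geometric) auto
  also have "\<dots> = 2" by (subst suminf_geometric) auto
  finally show ?thesis .
qed

lemma walk_bound_le:
  fixes \<rho> :: real
  assumes \<rho>: "0 < \<rho>" "\<rho> < 1"
  shows "\<exists>K>0. \<exists>k0. \<forall>k\<ge>k0. \<exists>N. \<forall>w. 0 \<le> w \<longrightarrow> w \<le> \<rho> * 2 ^ k \<longrightarrow> walk_bound n N (2 ^ k) w \<le> K / 2 ^ k"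
proof -
  \<comment> \<open>From \<open>2 * t \<le> q + 1\<close> follows
    \<open>2 * (q - t) \<ge> q - 1\<close>, so \<open>\<rho> ^ (q - t)\<close> is at most
    \<open>\<eta> ^ (q - 1)\<close>: half of the decay survives for every \<open>t\<close>.\<close>
  define \<eta> where "\<eta> = sqrt \<rho>"
  have \<eta>: "0 < \<eta>" "\<eta> < 1" "\<rho> = \<eta> ^ 2" using \<rho> by (simp_all add: \<eta>_def)
  define B where "B q = 4 * real (q + 1) ^ (2 * n + 2)" for q
  define S where "S = (\<Sum>p. real p ^ (2 * (2 * n + 2)) * \<eta> ^ p)"
  have summ: "summable (\<lambda>p. real p ^ (2 * (2 * n + 2)) * \<eta> ^ p)"
    by (rule summable_power_mult_geometric[OF \<eta>(1,2)])
  have Bsum: "(\<Sum>q\<in>{1..N}. \<eta> ^ (q - 1) * (B q)\<^sup>2) \<le> 16 / \<eta>\<^sup>2 * S" for N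
  proof -
    have "\<eta> ^ (q - 1) * (B q)\<^sup>2 = 16 / \<eta>\<^sup>2 * (real (Suc q) ^ (2 * (2 * n + 2)) * \<eta> ^ Suc q)" if "q \<ge> 1" for q
    proof -
      have "\<eta> ^ Suc q = \<eta> ^ (q - 1) * \<eta>\<^sup>2" using that by (cases q) (simp_all add: power2_eq_square)
      moreover have "(B q)\<^sup>2 = 16 * real (Suc q) ^ (2 * (2 * n + 2))"
        unfolding B_def power_mult_distrib by (simp only: mult.commute[of 2] power_mult Suc_eq_plus1) simp
      ultimately show ?thesis using \<eta> by simp
    qed
    then have "(\<Sum>q\<in>{1..N}. \<eta> ^ (q - 1) * (B q)\<^sup>2)
      = 16 / \<eta>\<^sup>2 * (\<Sum>q\<in>{1..N}. real (Suc q) ^ (2 * (2 * n + 2)) * \<eta> ^ Suc q)"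
      unfolding sum_distrib_left by (intro sum.cong refl) simp
    also have "\<dots> \<le> 16 / \<eta>\<^sup>2 * S"
    proof (rule mult_left_mono)
      have "(\<Sum>q\<in>{1..N}. real (Suc q) ^ (2 * (2 * n + 2)) * \<eta> ^ Suc q)
        = (\<Sum>p\<in>Suc ` {1..N}. real p ^ (2 * (2 * n + 2)) * \<eta> ^ p)"
        by (subst sum.reindex) auto
      also have "\<dots> \<le> S" unfolding S_def
        using \<eta> by (intro sum_le_suminf summ) auto
      finally show "(\<Sum>q\<in>{1..N}. real (Suc q) ^ (2 * (2 * n + 2)) * \<eta> ^ Suc q) \<le> S" .
    qed simp
    finally show ?thesis .
  qed
  \<comment> \<open>The walk length will be \<open>s * k\<close>: long enough for
    \<open>\<rho> ^ (s * k)\<close> to be at most \<open>1 / 2 ^ k\<close>, yet linear in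
    \<open>k\<close>, so that the polynomial \<open>B (s * k)\<close> is below half the alphabet
    size for large \<open>k\<close>.\<close>
  obtain s where s: "\<rho> ^ s < 1 / 2" using real_arch_pow_inv[of "1 / 2" \<rho>] \<rho> by auto
  have "\<exists>k0. \<forall>k\<ge>k0. B (s * k) / 2 ^ k \<le> 1 / 2"
  proof -
    let ?j = "2 * n + 2"
    have "(\<lambda>k. 8 * real (s + 1) ^ ?j * (real k ^ ?j * (1 / 2) ^ k)) \<longlonglongrightarrow> 8 * real (s + 1) ^ ?j * 0"
      by (intro tendsto_mult tendsto_const power_mult_geometric_tendsto_0) auto
    then have "eventually (\<lambda>k. 8 * real (s + 1) ^ ?j * (real k ^ ?j * (1 / 2) ^ k) < 1) sequentially"
      by (rule order_tendstoD(2)) simp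
    then obtain k0 where k0: "\<And>k. k \<ge> k0 \<Longrightarrow> 8 * real (s + 1) ^ ?j * (real k ^ ?j * (1 / 2) ^ k) < 1"
      by (auto simp: eventually_sequentially)
    have "B (s * k) / 2 ^ k \<le> 1 / 2" if k: "k \<ge> max k0 1" for k
    proof -
      have "real (s * k + 1) \<le> real ((s + 1) * k)" using k by (intro of_nat_mono) simp
      then have "real (s * k + 1) ^ ?j \<le> (real (s + 1) * real k) ^ ?j"
        unfolding of_nat_mult[symmetric] by (intro power_mono) simp_all
      then have "B (s * k) / 2 ^ k \<le> 4 * (real (s + 1) * real k) ^ ?j / 2 ^ k"
        unfolding B_def by (intro divide_right_mono mult_left_mono) auto
      also have "\<dots> = (8 * real (s + 1) ^ ?j * (real k ^ ?j * (1 / 2) ^ k)) / 2"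
        unfolding power_mult_distrib power_divide by simp
      also have "\<dots> \<le> 1 / 2" using less_imp_le[OF k0[of k]] k by (intro divide_right_mono) auto
      finally show ?thesis .
    qed
    then show ?thesis by blast
  qed
  then obtain k0 where k0: "\<And>k. k \<ge> k0 \<Longrightarrow> B (s * k) / 2 ^ k \<le> 1 / 2" by blast
  \<comment> \<open>One summand for each sum in \<open>walk_bound\<close>; the factor 2 bounds the
    geometric series over \<open>t\<close>.\<close>
  define K where "K = 1 + 1 / (1 - \<rho>) + 2 * (16 / \<eta>\<^sup>2 * S)"
  have "S \<ge> 0" unfolding S_def using \<eta> by (intro suminf_nonneg summ) auto
  then have K: "K > 0" using \<rho> unfolding K_def by (intro add_pos_nonneg) auto
  have "walk_bound n (s * k) (2 ^ k) w \<le> K / 2 ^ k" if k: "k \<ge> k0" and w: "0 \<le> w" "w \<le> \<rho> * 2 ^ k" for k w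
  proof -
    let ?m = "(2 :: real) ^ k" and ?N = "s * k"
    have wp: "w ^ i \<le> \<rho> ^ i * ?m ^ i" for i
      using power_mono[OF w(2,1), of i] by (simp only: power_mult_distrib)
    have first: "w ^ ?N / ?m ^ ?N \<le> 1 / ?m"
    proof -
      have "w ^ ?N / ?m ^ ?N \<le> \<rho> ^ ?N" using wp[of ?N] by (simp add: divide_le_eq)
      also have "\<dots> = (\<rho> ^ s) ^ k" by (simp only: power_mult)
      also have "\<dots> \<le> (1 / 2) ^ k" using s \<rho> by (intro power_mono) auto
      finally show ?thesis by (simp add: power_divide)
    qed
    have second: "(\<Sum>q\<in>{1..?N}. w ^ (q - 1) / ?m ^ q) \<le> (1 / (1 - \<rho>)) / ?m"
    proof -
      have "(\<Sum>q\<in>{1..?N}. w ^ (q - 1) / ?m ^ q) \<le> (\<Sum>q\<in>{1..?N}. \<rho> ^ (q - 1) / ?m)"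
      proof (rule sum_mono)
        fix q assume q: "q \<in> {1..?N}"
        then have "?m ^ q = ?m ^ (q - 1) * ?m" by (cases q) auto
        then show "w ^ (q - 1) / ?m ^ q \<le> \<rho> ^ (q - 1) / ?m"
          using wp[of "q - 1"] by (simp add: field_simps)
      qed
      also have "\<dots> = (\<Sum>i\<in>(\<lambda>q. q - 1) ` {1..?N}. \<rho> ^ i) / ?m"
        by (subst sum.reindex) (auto simp: inj_on_def sum_divide_distrib)
      also have "\<dots> \<le> (\<Sum>i. \<rho> ^ i) / ?m"
        using \<rho> by (intro divide_right_mono sum_le_suminf summable_geometric) auto
      also have "(\<Sum>i. \<rho> ^ i) = 1 / (1 - \<rho>)" using \<rho> by (intro suminf_geometric) simp
      finally show ?thesis .
    qed
    have third: "(\<Sum>q\<in>{1..?N}. \<Sum>t\<in>{2..(q + 1) div 2}.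
        real (q + 1) ^ (2 * t) * (tuple_factor n t * w ^ (q - t)) / ?m ^ (q - 1))
      \<le> (\<Sum>q\<in>{1..?N}. 2 * (\<eta> ^ (q - 1) * (B q)\<^sup>2)) / ?m"
      unfolding sum_divide_distrib
    proof (rule sum_mono)
      fix q assume q: "q \<in> {1..?N}"
      have Bq: "B q / ?m \<le> 1 / 2"
      proof -
        have "B q \<le> B ?N" 
          using q unfolding B_def by (intro mult_left_mono power_mono of_nat_mono) auto
        then have "B q / ?m \<le> B ?N / ?m" by (rule divide_right_mono) simp
        also have "\<dots> \<le> 1 / 2" by (rule k0[OF k])
        finally show ?thesis .
      qed
      have B0: "B q \<ge> 0" by (simp add: B_def)
      have "(\<Sum>t\<in>{2..(q + 1) div 2}. real (q + 1) ^ (2 * t) * (tuple_factor n t * w ^ (q - t)) / ?m ^ (q - 1))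
        \<le> (\<Sum>t\<in>{2..(q + 1) div 2}. (\<eta> ^ (q - 1) * (B q)\<^sup>2 / ?m) * (1 / 2) ^ (t - 2))"
      proof (rule sum_mono)
        fix t assume t: "t \<in> {2..(q + 1) div 2}"
        then have t2: "2 \<le> t" "2 * t \<le> q + 1" by auto
        have "real (q + 1) ^ (2 * t) * (tuple_factor n t * w ^ (q - t))
          = (real (q + 1) ^ (2 * t) * tuple_factor n t) * w ^ (q - t)" by simp
        also have "\<dots> \<le> B q ^ t * (\<rho> ^ (q - t) * ?m ^ (q - t))"
          unfolding B_def using w(1) by (intro mult_mono tuple_term_le[OF t2] wp) auto
        also have "\<rho> ^ (q - t) = \<eta> ^ (2 * (q - t))" by (simp add: \<eta>(3) power_mult)
        also have "B q ^ t * (\<eta> ^ (2 * (q - t)) * ?m ^ (q - t)) \<le> B q ^ t * (\<eta> ^ (q - 1) * ?m ^ (q - t))"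
          using \<eta> t2 B0 by (intro mult_left_mono mult_right_mono power_decreasing) auto
        finally have "real (q + 1) ^ (2 * t) * (tuple_factor n t * w ^ (q - t)) / ?m ^ (q - 1)
          \<le> B q ^ t * (\<eta> ^ (q - 1) * ?m ^ (q - t)) / ?m ^ (q - 1)"
          by (rule divide_right_mono) simp
        also have "\<dots> = (\<eta> ^ (q - 1) * (B q)\<^sup>2 / ?m) * (B q / ?m) ^ (t - 2)"
        proof -
          \<comment> \<open>One factor \<open>1 / ?m\<close> is kept as the gain, and each of the
            other \<open>t - 2\<close> is paired with a factor \<open>B q\<close>. The remaining
            \<open>(B q)\<^sup>2\<close> is absorbed by the convergent sum over
            \<open>q\<close>.\<close>
          have "q - 1 = (q - t) + (1 + (t - 2))" using t2 by auto
          then have "?m ^ (q - 1) = ?m ^ (q - t) * (?m * ?m ^ (t - 2))"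
            by (metis power_add power_one_right)
          moreover have "B q ^ t = (B q)\<^sup>2 * B q ^ (t - 2)" 
            using t2 by (simp only: power_add[symmetric] le_add_diff_inverse)
          ultimately show ?thesis by (simp add: power_divide)
        qed
        also have "\<dots> \<le> (\<eta> ^ (q - 1) * (B q)\<^sup>2 / ?m) * (1 / 2) ^ (t - 2)"
          using Bq B0 \<eta> by (intro mult_left_mono power_mono) auto
        finally show "real (q + 1) ^ (2 * t) * (tuple_factor n t * w ^ (q - t)) / ?m ^ (q - 1)
          \<le> (\<eta> ^ (q - 1) * (B q)\<^sup>2 / ?m) * (1 / 2) ^ (t - 2)" .
      qed
      also have "\<dots> \<le> (\<eta> ^ (q - 1) * (B q)\<^sup>2 / ?m) * 2"
        unfolding sum_distrib_left[symmetric] using \<eta> by (intro mult_left_mono sum_half_powers_le) auto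
      also have "\<dots> = 2 * (\<eta> ^ (q - 1) * (B q)\<^sup>2) / ?m" by simp
      finally show "(\<Sum>t\<in>{2..(q + 1) div 2}. real (q + 1) ^ (2 * t) * (tuple_factor n t * w ^ (q - t)) / ?m ^ (q - 1))
        \<le> 2 * (\<eta> ^ (q - 1) * (B q)\<^sup>2) / ?m" .
    qed
    also have "\<dots> \<le> 2 * (16 / \<eta>\<^sup>2 * S) / ?m"
      unfolding sum_distrib_left[symmetric] by (intro divide_right_mono mult_left_mono Bsum) auto
    finally have "walk_bound n ?N ?m w \<le> 1 / ?m + (1 / (1 - \<rho>)) / ?m + 2 * (16 / \<eta>\<^sup>2 * S) / ?m"
      unfolding walk_bound_def using first second by (intro add_mono)
    also have "\<dots> = K / ?m" unfolding K_def by (simp only: add_divide_distrib)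
    finally show ?thesis .
  qed
  then show ?thesis using K by blast
qed

subsection \<open>The bound for double tabulation\<close>

lemma mod_power_eqI:
  fixes x y b :: nat
  assumes "\<And>i. i < c \<Longrightarrow> x div b ^ i mod b = y div b ^ i mod b"
  shows "x mod b ^ c = y mod b ^ c"
  using assms
proof (induction c)
  case (Suc c)
  have "x mod b ^ Suc c = b ^ c * (x div b ^ c mod b) + x mod b ^ c" for x
    using mod_mult2_eq[of x "b ^ c" b] by (simp add: mult.commute)
  then show ?case using Suc by simp
qed simp

lemma inj_on_key_vec: "inj_on (key_vec k c) {..<(2 ^ k) ^ c}"
proof (rule inj_onI)
  fix x y assume xy: "x \<in> {..<(2 ^ k) ^ c}" "y \<in> {..<(2 ^ k) ^ c}" and eq: "key_vec k c x = key_vec k c y"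
  have "x mod (2 ^ k) ^ c = y mod (2 ^ k) ^ c"
  proof (rule mod_power_eqI)
    fix i assume i: "i < c"
    from eq have "key_vec k c x ! i = key_vec k c y ! i" by simp
    then show "x div (2 ^ k) ^ i mod 2 ^ k = y div (2 ^ k) ^ i mod 2 ^ k"
      using i by (simp add: key_vec_def)
  qed
  then show "x = y" using xy by simp
qed

lemma key_vec_in_vecs: "key_vec k c x \<in> vecs c (alphabet k)"
  by (auto simp: key_vec_def vecs_def alphabet_def)

lemma even_fibers_image:
  assumes "inj_on h Y"
  shows "even_fibers f (h ` Y) \<longleftrightarrow> even_fibers (\<lambda>y. f (h y)) Y"
proof -
  have "card {z \<in> h ` Y. f z = a} = card {y \<in> Y. f (h y) = a}" for a
  proof -
    have "{z \<in> h ` Y. f z = a} = h ` {y \<in> Y. f (h y) = a}" by auto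
    moreover have "inj_on h {y \<in> Y. f (h y) = a}" using assms by (rule inj_on_subset) auto
    ultimately show ?thesis by (simp add: card_image)
  qed
  then show ?thesis by (simp add: even_fibers_def)
qed

lemma simple_tab_table_coordinates:
  assumes "x \<in> vecs n A" "j < d"
  shows "simple_tab xor 0 (table_coordinates d n A T j) x = simple_tab xor (0 :: nat) (\<lambda>i a. T i a ! j) x"
proof -
  have "x ! i \<in> A" "length x = n" if "i < length x" for i
    using assms(1) that nth_mem[OF that] by (auto simp: vecs_def)
  then show ?thesis
    unfolding simple_tab_xor_eq_sum using assms(2)
    by (intro xor_nat.cong) (auto simp: table_coordinates_def)
qed

lemma fully_random_over_simple_tab_bits:
  assumes S: "finite S" and h: "\<And>x. x \<in> S \<Longrightarrow> h x \<in> vecs d (alphabet k)"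
    and ind: "independent_keys d h S"
  shows "fully_random_over (map_pmf (\<lambda>h2. h2 \<circ> h) (simple_tab_bits k d r)) S {..<2 ^ r}"
proof (rule fully_random_overI[OF S])
  have "map_pmf (\<lambda>g x. if x \<in> S then g x else undefined) (map_pmf (\<lambda>h2. h2 \<circ> h) (simple_tab_bits k d r))
    = map_pmf (\<lambda>T x. if x \<in> S then simple_tab xor 0 T (h x) else undefined)
        (random_tables d (alphabet k) {..<2 ^ r :: nat})"
    unfolding simple_tab_bits_def by (simp add: pmf.map_comp o_def)
  also have "\<dots> = Pi_pmf S undefined (\<lambda>_. pmf_of_set {..<2 ^ r})"
    by (rule simple_tab_independent_keys_uniform[OF S _ h ind]) (simp add: alphabet_def)
  finally show "map_pmf (\<lambda>g x. if x \<in> S then g x else undefined) (map_pmf (\<lambda>h2. h2 \<circ> h) (simple_tab_bits k d r))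
    = Pi_pmf S undefined (\<lambda>_. pmf_of_set {..<2 ^ r})" .
qed

lemma set_pmf_random_tables:
  assumes "finite A" "finite R" "R \<noteq> {}" "T \<in> set_pmf (random_tables n A R)" "i < n" "a \<in> A"
  shows "T i a \<in> R"
proof -
  have "PiE_dflt {..<n} undefined (\<lambda>_. PiE_dflt A undefined (\<lambda>_. R)) \<noteq> {}" using assms(3) by simp
  then have "T \<in> PiE_dflt {..<n} undefined (\<lambda>_. PiE_dflt A undefined (\<lambda>_. R))"
    using assms(4) set_pmf_of_set[OF _ finite_random_tables[OF assms(1,2)]]
    unfolding random_tables_eq_pmf_of_set[OF assms(1-3)] by blast
  then show ?thesis using assms(5,6) by (simp add: PiE_dflt_def)
qed

text \<open>All coordinates share the set \<open>Y\<close>, which would make the pair events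
  dependent. Only its first key \<open>x0\<close> is retained: for fixed \<open>x0\<close> every
  pair may use its own \<open>Y\<close> within \<open>later x0\<close>, so the events involve
  disjoint coordinates, and the union bound costs merely \<open>card V\<close>.\<close>

lemma prob_zero_sum_image_le:
  assumes V: "V \<subseteq> vecs c (alphabet k)"
    and later: "\<And>Y. Y \<subseteq> V \<Longrightarrow> Y \<noteq> {} \<Longrightarrow> \<exists>x\<in>Y. Y \<subseteq> later x"
    and pair: "\<And>x0. x0 \<in> V \<Longrightarrow> prob_pair c (alphabet k) k
        (\<lambda>f g. \<exists>Y\<subseteq>later x0. x0 \<in> Y \<and> even_fibers f Y \<and> even_fibers g Y) \<le> b"
  shows "measure_pmf.prob (random_tables c (alphabet k) (vecs d (alphabet k)))
      {T. \<exists>Y\<subseteq>V. Y \<noteq> {} \<and> (\<forall>j<d. even_fibers (simple_tab xor (0 :: nat) (\<lambda>i a. T i a ! j)) Y)}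
    \<le> real (card V) * b ^ (d div 2)"
proof -
  let ?A = "alphabet k" and ?D = "d div 2"
  let ?M = "random_tables c ?A {..<2 ^ k :: nat}"
  let ?Q = "\<lambda>x0 a b. \<exists>Y\<subseteq>later x0. x0 \<in> Y \<and> even_fibers (simple_tab xor (0 :: nat) a) Y \<and>
    even_fibers (simple_tab xor (0 :: nat) b) Y"
  let ?tc = "table_coordinates d c ?A"
  have A: "finite ?A" "?A \<noteq> {}" by (auto simp: alphabet_def lessThan_empty_iff)
  have fV: "finite V" using V by (rule finite_subset) (simp add: A)
  have "measure_pmf.prob (random_tables c ?A (vecs d ?A))
      {T. \<exists>Y\<subseteq>V. Y \<noteq> {} \<and> (\<forall>j<d. even_fibers (simple_tab xor (0 :: nat) (\<lambda>i a. T i a ! j)) Y)}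
    \<le> measure_pmf.prob (random_tables c ?A (vecs d ?A))
      (?tc -` {F. \<exists>x0\<in>V. \<forall>p<?D. ?Q x0 (F (2 * p)) (F (2 * p + 1))})"
  proof (rule measure_pmf.finite_measure_mono, rule subsetI)
    fix T assume "T \<in> {T. \<exists>Y\<subseteq>V. Y \<noteq> {} \<and> (\<forall>j<d. even_fibers (simple_tab xor (0 :: nat) (\<lambda>i a. T i a ! j)) Y)}"
    then obtain Y where Y: "Y \<subseteq> V" "Y \<noteq> {}"
      "\<And>j. j < d \<Longrightarrow> even_fibers (simple_tab xor (0 :: nat) (\<lambda>i a. T i a ! j)) Y" by blast
    obtain x0 where x0: "x0 \<in> Y" "Y \<subseteq> later x0" using later[OF Y(1,2)] by blast
    have ev: "even_fibers (simple_tab xor 0 (?tc T j)) Y" if j: "j < d" for j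
    proof -
      have "simple_tab xor 0 (?tc T j) y = simple_tab xor (0 :: nat) (\<lambda>i a. T i a ! j) y" if "y \<in> Y" for y
        using that Y(1) V j by (intro simple_tab_table_coordinates) auto
      then show ?thesis using Y(3)[OF j] by (simp cong: even_fibers_cong)
    qed
    have "?Q x0 (?tc T (2 * p)) (?tc T (2 * p + 1))" if "p < ?D" for p
    proof -
      have "2 * p < d" "2 * p + 1 < d" using that by auto
      then show ?thesis using ev x0 by blast
    qed
    then show "T \<in> ?tc -` {F. \<exists>x0\<in>V. \<forall>p<?D. ?Q x0 (F (2 * p)) (F (2 * p + 1))}"
      using x0(1) Y(1) by blast
  qed simp
  also have "\<dots> = measure_pmf.prob (map_pmf ?tc (random_tables c ?A (vecs d ?A)))
      {F. \<exists>x0\<in>V. \<forall>p<?D. ?Q x0 (F (2 * p)) (F (2 * p + 1))}"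
    by (simp only: measure_map_pmf)
  also have "map_pmf ?tc (random_tables c ?A (vecs d ?A)) = Pi_pmf {..<d} undefined (\<lambda>_. ?M)"
    using map_pmf_table_coordinates[OF A(1) A] by (simp add: alphabet_def)
  also have "measure_pmf.prob \<dots> {F. \<exists>x0\<in>V. \<forall>p<?D. ?Q x0 (F (2 * p)) (F (2 * p + 1))} \<le> real (card V) * b ^ ?D"
  proof (rule measure_pmf_union_bound[OF fV])
    fix x0 assume x0: "x0 \<in> V"
    have "measure_pmf.prob (Pi_pmf {..<d} undefined (\<lambda>_. ?M)) {F. \<forall>p<?D. ?Q x0 (F (2 * p)) (F (2 * p + 1))}
      = measure_pmf.prob (pair_pmf ?M ?M) {(a, b). ?Q x0 a b} ^ ?D"
      by (rule prob_matched_pairs_coordinates) simp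
    also have "\<dots> \<le> b ^ ?D"
      using pair[OF x0] unfolding prob_pair_def random_table_pair_def by (intro power_mono) simp_all
    finally show "measure_pmf.prob (Pi_pmf {..<d} undefined (\<lambda>_. ?M)) {F. \<forall>p<?D. ?Q x0 (F (2 * p)) (F (2 * p + 1))} \<le> b ^ ?D" .
  qed
  finally show ?thesis .
qed

lemma prob_fully_random_ge:
  assumes S: "finite S" and inj: "inj_on (key_vec k c) S"
    and later: "\<And>Y. Y \<subseteq> key_vec k c ` S \<Longrightarrow> Y \<noteq> {} \<Longrightarrow> \<exists>x\<in>Y. Y \<subseteq> later x"
    and pair: "\<And>x0. x0 \<in> key_vec k c ` S \<Longrightarrow> prob_pair c (alphabet k) k
        (\<lambda>f g. \<exists>Y\<subseteq>later x0. x0 \<in> Y \<and> even_fibers f Y \<and> even_fibers g Y) \<le> b"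
  shows "measure_pmf.prob (simple_tab_chars k c d)
       {h1. fully_random_over
          (map_pmf (\<lambda>h2. h2 \<circ> h1 \<circ> key_vec k c) (simple_tab_bits k d r)) S {..<2 ^ r}}
    \<ge> 1 - real (card S) * b ^ (d div 2)"
proof -
  let ?A = "alphabet k" and ?V = "key_vec k c ` S"
  let ?M = "random_tables c ?A (vecs d ?A)"
  let ?h = "simple_tab xor_vec (replicate d 0)"
  let ?FR = "{h1. fully_random_over (map_pmf (\<lambda>h2. h2 \<circ> h1 \<circ> key_vec k c) (simple_tab_bits k d r)) S {..<2 ^ r}}"
  let ?Z = "{T. \<exists>Y\<subseteq>?V. Y \<noteq> {} \<and> (\<forall>j<d. even_fibers (simple_tab xor (0 :: nat) (\<lambda>i a. T i a ! j)) Y)}"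
  have A: "finite ?A" by (simp add: alphabet_def)
  have ne: "vecs d ?A \<noteq> {}" using key_vec_in_vecs[of k d 0] by blast
  \<comment> \<open>On the support all entries read by keys are vectors of length \<open>d\<close>
    over the alphabet, which coordinatewise hashing requires.\<close>
  have sub: "(- (?h -` ?FR)) \<inter> set_pmf ?M \<subseteq> ?Z"
  proof
    fix T assume T: "T \<in> (- (?h -` ?FR)) \<inter> set_pmf ?M"
    have Tv: "T i a \<in> vecs d ?A" if "i < c" "a \<in> ?A" for i a
      using T that by (intro set_pmf_random_tables[OF A _ ne]) (auto simp: A)
    let ?x = "\<lambda>s. ?h T (key_vec k c s)"
    have Tk: "T i (key_vec k c s ! i) \<in> vecs d ?A" if "i < length (key_vec k c s)" for i s
      using key_vec_in_vecs[of k c s] nth_mem[OF that] that by (intro Tv) (auto simp: vecs_def)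
    then have lenT: "length (T i (key_vec k c s ! i)) = d" if "i < length (key_vec k c s)" for i s
      using that by (simp add: vecs_def)
    have len: "length (?x s) = d"
      and nth: "\<And>j. j < d \<Longrightarrow> ?x s ! j = simple_tab xor 0 (\<lambda>i a. T i a ! j) (key_vec k c s)" for s
      using simple_tab_xor_vec[of "key_vec k c s" T d] lenT by auto
    have xv: "?x s \<in> vecs d ?A" for s
    proof -
      have "?x s ! j < 2 ^ k" if j: "j < d" for j
        unfolding nth[OF j]
      proof (rule simple_tab_xor_less)
        fix p assume p: "p < length (key_vec k c s)"
        have "T p (key_vec k c s ! p) ! j \<in> set (T p (key_vec k c s ! p))"
          using lenT[OF p] j by simp
        also have "\<dots> \<subseteq> ?A" using Tk[OF p] by (simp add: vecs_def)
        finally show "T p (key_vec k c s ! p) ! j < 2 ^ k" by (simp add: alphabet_def)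
      qed
      then have "y \<in> ?A" if "y \<in> set (?x s)" for y
        using that len[of s] unfolding alphabet_def by (metis in_set_conv_nth lessThan_iff)
      then show ?thesis using len[of s] unfolding vecs_def by blast
    qed
    have "\<not> independent_keys d ?x S"
    proof
      assume "independent_keys d ?x S"
      then have "fully_random_over (map_pmf (\<lambda>h2. h2 \<circ> ?x) (simple_tab_bits k d r)) S {..<2 ^ r}"
        by (intro fully_random_over_simple_tab_bits[OF S xv])
      then show False using T by (simp add: o_def)
    qed
    then obtain Y where Y: "Y \<subseteq> S" "Y \<noteq> {}" "zero_sum d ?x Y"
      by (auto simp: independent_keys_def)
    have "even_fibers (simple_tab xor (0 :: nat) (\<lambda>i a. T i a ! j)) (key_vec k c ` Y)" if j: "j < d" for j
    proof -
      have "even_fibers (\<lambda>s. ?x s ! j) Y" using Y(3) j by (simp add: zero_sum_def)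
      then show ?thesis
        using inj_on_subset[OF inj Y(1)] by (simp add: even_fibers_image nth[OF j])
    qed
    then show "T \<in> ?Z" using Y(1,2) by (intro CollectI exI[of _ "key_vec k c ` Y"]) auto
  qed
  have "1 - measure_pmf.prob (simple_tab_chars k c d) ?FR = measure_pmf.prob (simple_tab_chars k c d) (- ?FR)"
    using measure_pmf.prob_compl[of ?FR "simple_tab_chars k c d"] by (simp add: Compl_eq_Diff_UNIV)
  also have "\<dots> = measure_pmf.prob ?M (- (?h -` ?FR))"
    unfolding simple_tab_chars_def measure_map_pmf by (simp add: vimage_Compl)
  also have "\<dots> = measure_pmf.prob ?M ((- (?h -` ?FR)) \<inter> set_pmf ?M)"
    by (simp add: measure_Int_set_pmf)
  also have "\<dots> \<le> measure_pmf.prob ?M ?Z"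
    by (rule measure_pmf.finite_measure_mono[OF sub]) simp
  also have "\<dots> \<le> real (card ?V) * b ^ (d div 2)"
    by (rule prob_zero_sum_image_le[OF _ later pair]) (auto intro: key_vec_in_vecs)
  also have "card ?V = card S" using inj by (rule card_image)
  finally show ?thesis by linarith
qed

theorem theorem6:
  fixes c d :: nat and \<epsilon> :: real
  assumes "c \<ge> 1" and "d \<ge> 1" and "\<epsilon> > 0"
  shows "\<exists>C::real. C > 0 \<and>
    (\<forall>(k::nat) (u::nat) (r::nat) (S::nat set).
       real u powr (1 / real c) \<le> real (card (alphabet k)) \<longrightarrow>
       (c > 1 \<longrightarrow> real (card (alphabet k)) \<le> real u powr (1 / (real c - 1))) \<longrightarrow>
       S \<subseteq> {..<u} \<longrightarrow>
       real (card S) \<le> real (card (alphabet k)) / (1 + \<epsilon>) \<longrightarrow>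
       measure_pmf.prob (simple_tab_chars k c d)
         {h1. fully_random_over
                (map_pmf (\<lambda>h2. h2 \<circ> h1 \<circ> key_vec k c) (simple_tab_bits k d r)) S {..<2 ^ r}}
       \<ge> 1 - C * real (card (alphabet k)) powi (1 - \<lfloor>real d / 2\<rfloor>))"
proof -
  define \<rho> where "\<rho> = 1 / (1 + \<epsilon>)"
  have \<rho>: "0 < \<rho>" "\<rho> < 1" using assms(3) by (simp_all add: \<rho>_def)
  obtain K k0 where K: "K > 0" "\<And>k. k \<ge> k0 \<Longrightarrow> \<exists>N. \<forall>w. 0 \<le> w \<longrightarrow> w \<le> \<rho> * 2 ^ k \<longrightarrow>
      walk_bound c N (2 ^ k) w \<le> K / 2 ^ k"
    using walk_bound_le[OF \<rho>, of c] by blast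
  \<comment> \<open>For \<open>k\<close> below \<open>k0\<close> the term \<open>2 ^ k0\<close>
    makes \<open>L / 2 ^ k\<close> at least 1, so the bound on a pair of coordinates is trivial
    there.\<close>
  define L where "L = max K (2 ^ k0)"
  have L: "L > 0" using K(1) by (simp add: L_def)
  have "1 - L ^ (d div 2) * real (card (alphabet k)) powi (1 - \<lfloor>real d / 2\<rfloor>)
      \<le> measure_pmf.prob (simple_tab_chars k c d)
         {h1. fully_random_over
                (map_pmf (\<lambda>h2. h2 \<circ> h1 \<circ> key_vec k c) (simple_tab_bits k d r)) S {..<2 ^ r}}"
    if u: "real u powr (1 / real c) \<le> real (card (alphabet k))" and S: "S \<subseteq> {..<u}"
      and cS: "real (card S) \<le> real (card (alphabet k)) / (1 + \<epsilon>)" for k u r S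
  proof -
    let ?A = "alphabet k" and ?m = "(2 :: real) ^ k" and ?D = "d div 2"
    have cA: "real (card ?A) = ?m" by (simp add: alphabet_def)
    have A: "finite ?A" by (simp add: alphabet_def)
    have fS: "finite S" using S by (rule finite_subset) simp
    \<comment> \<open>The lower bound on the alphabet size makes \<open>c\<close> digits enough to
      distinguish all keys.\<close>
    have "u \<le> (2 ^ k) ^ c"
    proof (cases "u = 0")
      case False
      have "real u = (real u powr (1 / real c)) ^ c"
        using False assms(1) by (simp add: powr_powr flip: powr_realpow)
      also have "\<dots> \<le> ?m ^ c" using u cA by (intro power_mono) auto
      finally have "real u \<le> real ((2 ^ k) ^ c)" by simp
      then show ?thesis by (simp only: of_nat_le_iff)
    qed simp
    then have inj: "inj_on (key_vec k c) S"
      using S by (intro inj_on_subset[OF inj_on_key_vec]) auto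
    let ?V = "key_vec k c ` S"
    have V: "?V \<subseteq> vecs c ?A" using key_vec_in_vecs by blast
    have cV: "real (card ?V) \<le> \<rho> * ?m"
      using cS cA card_image[OF inj] by (simp add: \<rho>_def)
    \<comment> \<open>\<open>N\<close> must be fixed before the elimination order, since goodness
      refers to it. The condition on \<open>k\<close> stays inside the quantifier so that an
      \<open>N\<close> is available for small \<open>k\<close> too.\<close>
    have "\<exists>N. k \<ge> k0 \<longrightarrow> (\<forall>w. 0 \<le> w \<longrightarrow> w \<le> \<rho> * 2 ^ k \<longrightarrow> walk_bound c N (2 ^ k) w \<le> K / 2 ^ k)"
      using K(2) by blast
    then obtain N where N: "\<And>w. k \<ge> k0 \<Longrightarrow> 0 \<le> w \<Longrightarrow> w \<le> \<rho> * 2 ^ k \<Longrightarrow> walk_bound c N (2 ^ k) w \<le> K / 2 ^ k"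
      by blast
    have "\<exists>later. (\<forall>x\<in>?V. later x \<subseteq> ?V \<and> x \<in> later x \<and> good_key c N x (later x)) \<and>
      (\<forall>Y. Y \<subseteq> ?V \<longrightarrow> Y \<noteq> {} \<longrightarrow> (\<exists>x\<in>Y. Y \<subseteq> later x))"
      using fS V by (intro exists_elimination_order exists_good_key[OF A]) auto
    then obtain later where
      l: "(\<forall>x\<in>?V. later x \<subseteq> ?V \<and> x \<in> later x \<and> good_key c N x (later x)) \<and>
        (\<forall>Y. Y \<subseteq> ?V \<longrightarrow> Y \<noteq> {} \<longrightarrow> (\<exists>x\<in>Y. Y \<subseteq> later x))" ..
    have later: "later x \<subseteq> ?V \<and> x \<in> later x \<and> good_key c N x (later x)" if "x \<in> ?V" for x
      using bspec[OF conjunct1[OF l] that] .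
    have cover: "\<exists>x\<in>Y. Y \<subseteq> later x" if "Y \<subseteq> ?V" "Y \<noteq> {}" for Y
      using conjunct2[OF l] that by simp
    have pair: "prob_pair c ?A k (\<lambda>f g. \<exists>Y\<subseteq>later x0. x0 \<in> Y \<and> even_fibers f Y \<and> even_fibers g Y) \<le> L / ?m"
      if x0: "x0 \<in> ?V" for x0
    proof (cases "k \<ge> k0")
      case True
      have "card (later x0) \<le> card ?V" using later[OF x0] fS by (intro card_mono) auto
      then have w: "real (card (later x0)) \<le> \<rho> * ?m" using cV by linarith
      have "prob_pair c ?A k (\<lambda>f g. \<exists>Y\<subseteq>later x0. x0 \<in> Y \<and> even_fibers f Y \<and> even_fibers g Y)
        \<le> walk_bound c N ?m (real (card (later x0)))"
        using later[OF x0] V assms(1) by (intro prob_even_fibers_le[OF A]) auto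
      also have "\<dots> \<le> K / ?m" using N[OF True _ w] by simp
      also have "\<dots> \<le> L / ?m" unfolding L_def by (intro divide_right_mono) auto
      finally show ?thesis .
    next
      case False
      have "?m \<le> 2 ^ k0" using False by (intro power_increasing) auto
      then have "?m \<le> L" by (simp add: L_def le_max_iff_disj)
      then have "1 \<le> L / ?m" by simp
      then show ?thesis using prob_pair_le_1 order_trans by blast
    qed
    \<comment> \<open>The choice of the starting key costs at most one factor of the alphabet size,
      the summand 1 of the exponent.\<close>
    have "real (card S) * (L / ?m) ^ ?D \<le> ?m * (L / ?m) ^ ?D"
    proof (rule mult_right_mono)
      have "\<rho> * ?m \<le> 1 * ?m" using \<rho> by (intro mult_right_mono) auto
      then show "real (card S) \<le> ?m" using cV unfolding card_image[OF inj] by linarith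
    qed (use L in simp)
    also have "\<dots> = L ^ ?D * real (card ?A) powi (1 - \<lfloor>real d / 2\<rfloor>)"
    proof -
      have "\<lfloor>real d / 2\<rfloor> = int ?D" using floor_divide_of_nat_eq[of d 2] by simp
      then show ?thesis by (simp add: cA power_int_diff power_divide)
    qed
    finally show ?thesis
      using prob_fully_random_ge[OF fS inj cover pair, of d r] by linarith
  qed
  then show ?thesis using L by (intro exI[of _ "L ^ (d div 2)"]) auto
qed

end
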